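(* Let $T:\mathbb{T}\to\mathbb{T}$ be a degree $k$ self-covering of the circle with a neutral fixed point $0$, uniformly expanding outside each neighborhood of $0$. For any $\alpha\in(0,1]$, let $V$ be the linear space of potentials in $\mathcal{C}^\alpha(\mathbb{T})$ which are constant on some neighborhood of $0$. Then for all $A\in V$, the transfer operator $\mathscr{L}_{T,A}$ acting on $\mathcal{C}^\alpha(\mathbb{T})$ has a spectral gap. Moreover, for all $\gamma\in(0,\alpha)$, $V$ is dense in $\mathcal{C}^\alpha(\mathbb{T})$ for the $\gamma$-Hölder norm.
   Context: $\mathbb{T}=\mathbb{R}/\mathbb{Z}$ with its usual distance $d$. The hypotheses on $T$ mean: $T$ is a $k$-to-$1$ covering map ($k\ge2$); $T(0)=0$ and $0$ is neutral (at least one one-sided derivative of $T$ at $0$ exists and has absolute value $1$); and for every neighborhood $N$ of $0$ there is $\lambda=\lambda(N)>1$ such that $|T'|\ge\lambda$ outside $N$ (if $T$ is not differentiable everywhere, this is required at the points outside $N$ where $T$ is differentiable). No particular behavior of $T$ near the neutral point is otherwise imposed. For $\alpha\in(0,1]$, $\mathcal{C}^\alpha(\mathbb{T})$ is the Banach space of functions $f:\mathbb{T}\to\mathbb{R}$ with $|f(x)-f(y)|\le C\,d(x,y)^\alpha$ for some $C$ (least such $C$ denoted $\mathrm{Hol}_\alpha(f)$), with $\alpha$-Hölder norm $\|f\|_\alpha=\|f\|_\infty+\mathrm{Hol}_\alpha(f)$; $\mathcal{C}^1$ means Lipschitz. Transfer operator: $\mathscr{L}_{T,A}f(x)=\sum_{T(y)=x}e^{A(y)}f(y)$.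 An operator $\mathscr{L}=\mathscr{L}_{T,A}$ acting continuously on a Banach space $\mathcal{X}$ of functions has a spectral gap if (i) there exist a positive function $h\in\mathcal{X}$, a constant $\rho>0$ and a nonzero positive finite measure $\nu$ such that $\mathscr{L}h=\rho h$ and $\mathscr{L}^*\nu=\rho\nu$ (i.e. $\int\mathscr{L}f\,d\nu=\rho\int f\,d\nu$ for all $f\in\mathcal{X}$), and (ii) there are $C\ge1$, $\delta\in(0,1)$ such that for all $t\in\mathbb{N}$ and all $f\in\mathcal{X}$ with $\nu(f)=0$, $\|\mathscr{L}^tf\|\le C\rho^t(1-\delta)^t\|f\|$. *)

theory Defs
  imports "HOL-Analysis.Analysis"
begin

section \<open>The circle\<close>

quotient_type circle = real / "\<lambda>x y :: real. x - y \<in> \<int>"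
proof (rule equivpI)
  show "reflp (\<lambda>x y :: real. x - y \<in> \<int>)"
    by (simp add: reflp_def)
  show "symp (\<lambda>x y :: real. x - y \<in> \<int>)"
    by (metis (no_types, lifting) Ints_minus minus_diff_eq sympI)
  show "transp (\<lambda>x y :: real. x - y \<in> \<int>)"
  proof (rule transpI)
    fix x y z :: real
    assume "x - y \<in> \<int>" "y - z \<in> \<int>"
    then have "(x - y) + (y - z) \<in> \<int>" by (rule Ints_add)
    then show "x - z \<in> \<int>" by simp
  qed
qed

lift_definition to_circle :: "real \<Rightarrow> circle" is "\<lambda>x. x" .

lemma to_circle_eq_iff: "to_circle x = to_circle y \<longleftrightarrow> x - y \<in> \<int>"
  by transfer simp

lemma to_circle_surj: "\<exists>t. to_circle t = p"
  by transfer (metis Ints_0 diff_self)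

instantiation circle :: zero
begin
lift_definition zero_circle :: circle is "0 :: real" .
instance ..
end

lemma zero_circle_eq: "0 = to_circle 0"
  by transfer simp

lemma abs_diff_round_add_Ints:
  fixes z :: real
  assumes "k \<in> \<int>"
  shows "\<bar>(z + k) - of_int (round (z + k))\<bar> = \<bar>z - of_int (round z)\<bar>"
proof -
  obtain n where n: "k = of_int n" using assms by (elim Ints_cases)
  have "round (z + k) = round z + n"
    unfolding n round_def by (metis add.commute add.left_commute floor_add_int)
  then show ?thesis by (simp add: n)
qed

text \<open>
  The distance is the quotient distance: \<open>round\<close> picks a nearest integer, so that
  \<open>\<bar>z - round z\<bar>\<close> is the minimum of \<open>\<bar>z - n\<bar>\<close> over all integers \<open>n\<close>.
\<close>

instantiation circle :: metric_space
begin

lift_definition dist_circle :: "circle \<Rightarrow> circle \<Rightarrow> real"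
  is "\<lambda>x y :: real. \<bar>(x - y) - of_int (round (x - y))\<bar>"
proof -
  fix x x' y y' :: real
  assume "x - x' \<in> \<int>" "y - y' \<in> \<int>"
  then have "(x - x') - (y - y') \<in> \<int>" by (rule Ints_diff)
  from abs_diff_round_add_Ints[OF this, of "x' - y'"]
  show "\<bar>(x - y) - of_int (round (x - y))\<bar> = \<bar>(x' - y') - of_int (round (x' - y'))\<bar>"
    by simp
qed

definition uniformity_circle :: "(circle \<times> circle) filter"
  where "uniformity_circle = (INF e\<in>{0 <..}. principal {(x, y). dist x y < e})"

definition open_circle :: "circle set \<Rightarrow> bool"
  where "open_circle U \<longleftrightarrow> (\<forall>x\<in>U. \<forall>\<^sub>F (x', y) in uniformity. x' = x \<longrightarrow> y \<in> U)"

instance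
proof
  fix p q r :: circle
  show "dist p q = 0 \<longleftrightarrow> p = q"
  proof (transfer)
    fix x y :: real
    have "x - y = of_int (round (x - y))" if "x - y \<in> \<int>"
      using that by (metis Ints_cases round_of_int)
    moreover have "x - y \<in> \<int>" if "x - y = of_int (round (x - y))"
      using that by (metis Ints_of_int)
    ultimately show "\<bar>x - y - of_int (round (x - y))\<bar> = 0 \<longleftrightarrow> x - y \<in> \<int>"
      by auto
  qed
  show "dist p q \<le> dist p r + dist q r"
  proof (transfer)
    fix x y z :: real
    have "\<bar>x - y - of_int (round (x - y))\<bar>
            \<le> \<bar>(x - y) - of_int (round (x - z) - round (y - z))\<bar>"
      by (rule round_diff_minimal)
    also have "\<dots> \<le> \<bar>x - z - of_int (round (x - z))\<bar> + \<bar>y - z - of_int (round (y - z))\<bar>"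
      by simp
    finally show "\<bar>x - y - of_int (round (x - y))\<bar>
            \<le> \<bar>x - z - of_int (round (x - z))\<bar> + \<bar>y - z - of_int (round (y - z))\<bar>" .
  qed
qed (simp_all only: uniformity_circle_def open_circle_def)

end

lemma dist_to_circle:
  "dist (to_circle x) (to_circle y) = \<bar>(x - y) - of_int (round (x - y))\<bar>"
  by transfer simp

lemma dist_circle_le_half: "dist (p :: circle) q \<le> 1 / 2"
  by transfer (metis of_int_round_abs_le abs_minus_commute)


section \<open>Circle maps with a neutral fixed point\<close>

definition circle_lift :: "(circle \<Rightarrow> circle) \<Rightarrow> (real \<Rightarrow> real) \<Rightarrow> bool"
  where "circle_lift T F \<longleftrightarrow>
    continuous_on UNIV F \<and> (\<forall>t. T (to_circle t) = to_circle (F t))"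

text \<open>
  The derivative at \<open>p\<close> is that of a lift at a representative of \<open>p\<close>. Every continuous circle
  map has a lift, unique up to an integer constant, so this depends neither on the lift nor on the
  representative. The last argument is the filter along which the derivative is taken:
  \<open>at\<close>, or \<open>at_left\<close> and \<open>at_right\<close> for the one-sided derivatives.
\<close>

definition has_circle_derivative ::
    "(circle \<Rightarrow> circle) \<Rightarrow> real \<Rightarrow> circle \<Rightarrow> (real \<Rightarrow> real filter) \<Rightarrow> bool"
  where "has_circle_derivative T D p G \<longleftrightarrow>
    (\<exists>F t. circle_lift T F \<and> to_circle t = p \<and> (F has_real_derivative D) (G t))"

definition neutral_at :: "(circle \<Rightarrow> circle) \<Rightarrow> circle \<Rightarrow> bool"
  where "neutral_at T p \<longleftrightarrow>
    (\<exists>D. \<bar>D\<bar> = 1 \<and>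
      (has_circle_derivative T D p (\<lambda>t. at_left t) \<or> has_circle_derivative T D p (\<lambda>t. at_right t)))"

definition uniformly_expanding_away_from :: "(circle \<Rightarrow> circle) \<Rightarrow> circle \<Rightarrow> bool"
  where "uniformly_expanding_away_from T p \<longleftrightarrow>
    (\<forall>N. p \<in> interior N \<longrightarrow>
      (\<exists>r>1. \<forall>x D. x \<notin> N \<longrightarrow> has_circle_derivative T D x (\<lambda>t. at t) \<longrightarrow> \<bar>D\<bar> \<ge> r))"


section \<open>Hoelder functions\<close>

definition holder_space :: "real \<Rightarrow> (circle \<Rightarrow> real) set"
  where "holder_space \<alpha> = {f. \<exists>C. \<forall>x y. \<bar>f x - f y\<bar> \<le> C * dist x y powr \<alpha>}"

definition holder_const :: "real \<Rightarrow> (circle \<Rightarrow> real) \<Rightarrow> real"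
  where "holder_const \<alpha> f = Inf {C. 0 \<le> C \<and> (\<forall>x y. \<bar>f x - f y\<bar> \<le> C * dist x y powr \<alpha>)}"

definition holder_norm :: "real \<Rightarrow> (circle \<Rightarrow> real) \<Rightarrow> real"
  where "holder_norm \<alpha> f = (SUP x. \<bar>f x\<bar>) + holder_const \<alpha> f"

lemma holder_space_antimono:
  assumes "\<gamma> \<le> \<alpha>"
  shows "holder_space \<alpha> \<subseteq> holder_space \<gamma>"
proof
  fix f assume "f \<in> holder_space \<alpha>"
  then obtain C where C: "\<And>x y. \<bar>f x - f y\<bar> \<le> C * dist x y powr \<alpha>"
    by (auto simp: holder_space_def)
  have "\<bar>f x - f y\<bar> \<le> \<bar>C\<bar> * dist x y powr \<gamma>" for x y
  proof (cases "x = y")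
    case False
    have "dist x y \<le> 1" using dist_circle_le_half[of x y] by simp
    with False have "dist x y powr \<alpha> \<le> dist x y powr \<gamma>"
      by (intro powr_mono' assms) auto
    then have "C * dist x y powr \<alpha> \<le> \<bar>C\<bar> * dist x y powr \<gamma>"
      by (intro mult_mono) auto
    with C[of x y] show ?thesis by linarith
  qed simp
  then show "f \<in> holder_space \<gamma>" by (auto simp: holder_space_def)
qed

definition flat_potentials :: "real \<Rightarrow> (circle \<Rightarrow> real) set"
  where "flat_potentials \<alpha> = {A \<in> holder_space \<alpha>. \<exists>N. 0 \<in> interior N \<and> A constant_on N}"

lemma holder_space_linear:
  assumes "f \<in> holder_space \<alpha>" "g \<in> holder_space \<alpha>"
  shows "(\<lambda>x. a * f x + b * g x) \<in> holder_space \<alpha>"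
proof -
  obtain C D where C: "\<And>x y. \<bar>f x - f y\<bar> \<le> C * dist x y powr \<alpha>"
    and D: "\<And>x y. \<bar>g x - g y\<bar> \<le> D * dist x y powr \<alpha>"
    using assms by (auto simp: holder_space_def)
  have "\<bar>(a * f x + b * g x) - (a * f y + b * g y)\<bar>
          \<le> (\<bar>a\<bar> * C + \<bar>b\<bar> * D) * dist x y powr \<alpha>" for x y
  proof -
    have "(a * f x + b * g x) - (a * f y + b * g y) = a * (f x - f y) + b * (g x - g y)"
      by (simp add: algebra_simps)
    also have "\<bar>\<dots>\<bar> \<le> \<bar>a\<bar> * \<bar>f x - f y\<bar> + \<bar>b\<bar> * \<bar>g x - g y\<bar>"
      by (metis abs_mult abs_triangle_ineq)
    also have "\<dots> \<le> \<bar>a\<bar> * (C * dist x y powr \<alpha>) + \<bar>b\<bar> * (D * dist x y powr \<alpha>)"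
      by (intro add_mono mult_left_mono C D) auto
    finally show ?thesis by (simp add: algebra_simps)
  qed
  then show ?thesis unfolding holder_space_def by blast
qed

lemma flat_potentials_linear:
  assumes "A \<in> flat_potentials \<alpha>" "B \<in> flat_potentials \<alpha>"
  shows "(\<lambda>x. a * A x + b * B x) \<in> flat_potentials \<alpha>"
proof -
  obtain M N where "0 \<in> interior M" "A constant_on M" "0 \<in> interior N" "B constant_on N"
    using assms by (auto simp: flat_potentials_def)
  then have "0 \<in> interior (M \<inter> N)" "(\<lambda>x. a * A x + b * B x) constant_on (M \<inter> N)"
    by (auto simp: constant_on_def)
  moreover have "(\<lambda>x. a * A x + b * B x) \<in> holder_space \<alpha>"
    using assms by (intro holder_space_linear) (auto simp: flat_potentials_def)
  ultimately show ?thesis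
    unfolding flat_potentials_def by blast
qed

lemma zero_in_flat_potentials: "(\<lambda>x. 0) \<in> flat_potentials \<alpha>"
  by (auto simp: flat_potentials_def holder_space_def constant_on_def
           intro!: exI[of _ "UNIV :: circle set"] exI[of _ "0 :: real"])

definition dense_for_norm ::
    "((circle \<Rightarrow> real) \<Rightarrow> real) \<Rightarrow> (circle \<Rightarrow> real) set \<Rightarrow> (circle \<Rightarrow> real) set \<Rightarrow> bool"
  where "dense_for_norm nrm V X \<longleftrightarrow>
    V \<subseteq> X \<and> (\<forall>f\<in>X. \<forall>\<epsilon>>0. \<exists>g\<in>V. nrm (\<lambda>x. f x - g x) < \<epsilon>)"


section \<open>Transfer operators and spectral gap\<close>

definition transfer_operator ::
    "(circle \<Rightarrow> circle) \<Rightarrow> (circle \<Rightarrow> real) \<Rightarrow> (circle \<Rightarrow> real) \<Rightarrow> circle \<Rightarrow> real"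
  where "transfer_operator T A f x = (\<Sum>y | T y = x. exp (A y) * f y)"

definition acts_continuously ::
    "(circle \<Rightarrow> real) set \<Rightarrow> ((circle \<Rightarrow> real) \<Rightarrow> real) \<Rightarrow>
     ((circle \<Rightarrow> real) \<Rightarrow> circle \<Rightarrow> real) \<Rightarrow> bool"
  where "acts_continuously X nrm L \<longleftrightarrow>
    (\<forall>f\<in>X. L f \<in> X) \<and> (\<exists>B. \<forall>f\<in>X. nrm (L f) \<le> B * nrm f)"

definition has_spectral_gap ::
    "(circle \<Rightarrow> real) set \<Rightarrow> ((circle \<Rightarrow> real) \<Rightarrow> real) \<Rightarrow>
     ((circle \<Rightarrow> real) \<Rightarrow> circle \<Rightarrow> real) \<Rightarrow> bool"
  where "has_spectral_gap X nrm L \<longleftrightarrow>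
    acts_continuously X nrm L \<and>
    (\<exists>h \<rho> (\<nu> :: circle measure).
       h \<in> X \<and> (\<forall>x. h x > 0) \<and> \<rho> > 0 \<and>
       sets \<nu> = sets borel \<and> finite_measure \<nu> \<and> emeasure \<nu> UNIV \<noteq> 0 \<and>
       (\<forall>x. L h x = \<rho> * h x) \<and>
       (\<forall>f\<in>X. integral\<^sup>L \<nu> (L f) = \<rho> * integral\<^sup>L \<nu> f) \<and>
       (\<exists>C \<delta>. C \<ge> 1 \<and> 0 < \<delta> \<and> \<delta> < 1 \<and>
          (\<forall>t. \<forall>f\<in>X. integral\<^sup>L \<nu> f = 0 \<longrightarrow>
             nrm ((L ^^ t) f) \<le> C * \<rho> ^ t * (1 - \<delta>) ^ t * nrm f)))"

end

theory Submission
  imports Defs "HOL-Probability.Probability"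
begin

text \<open>
  Two lifts of nearby points through an inverse branch of \<open>T\<close> are never further apart than the
  points themselves, and are closer by a fixed factor unless both lie in the small ball around \<open>0\<close>
  where \<open>A\<close> is constant. Hence on each branch either the potential causes no distortion or the
  distance contracts strictly, and since \<open>T\<close> is injective near \<open>0\<close> at least one of the \<open>k \<ge> 2\<close>
  branches contracts strictly. As its weight is bounded below, the transfer operator maps the
  cone of functions \<open>f \<ge> 0\<close> with \<open>f x \<le> exp (K d(x,y)\<^sup>\<alpha>) f y\<close> into the same cone for a
  smaller constant \<open>K'\<close>. That smaller cone has finite projective diameter in the larger one, so
  Birkhoff's contraction argument yields the eigendata and the spectral gap; the eigenmeasure is
  a weak limit provided by Helly's theorem.

  The derivative hypothesis only concerns the points where \<open>T\<close> is differentiable. That it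
  controls the increments of a lift is a form of Lebesgue's differentiation theorem for monotone
  functions, proved with F. Riesz's rising sun lemma.
\<close>

section \<open>Increments of continuous monotone functions\<close>

text \<open>The obstacle is that the inverse branch at the neutral point may contract at no uniform
  rate, so a Hoelder seminorm need not shrink on every branch. Flatness of \<open>A\<close> near
  \<open>0\<close> restores no contraction there; it only ensures that such a branch does not worsen
  a bound \<open>exp (K * u)\<close> on ratios. The gain has to come from averaging over the fibre:
  a strictly contracting branch must carry a definite share of the sum. Shares make sense for
  positive terms of comparable size, which is why cones of functions with controlled logarithm
  replace a seminorm estimate.

  The spectral data grow out of one functional: \<open>ell g\<close> is the limit of the ratios of
  \<open>(L ^^ n) g\<close> and \<open>(L ^^ n) 1\<close> at \<open>0\<close>. The eigenvalue is
  \<open>\<rho> = ell (L 1)\<close>, and the eigenfunction is the limit of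
  \<open>(L ^^ n) 1 / \<rho> ^ n\<close>. The ratios are integrals against finitely supported
  probability measures. Since they converge along the whole sequence, any weak limit point of these
  measures represents \<open>ell\<close> on Hoelder functions, and so inherits both the eigenvalue
  equation and the decay on the kernel of \<open>ell\<close>.\<close>

text \<open>Maximality of a component keeps its endpoints out of \<open>E\<close>. The rising sun
  lemmas start from exactly this: an interval of steep points with an endpoint that is not
  steep.\<close>

lemma component_of_bounded_open_real:
  fixes E :: "real set"
  assumes "open E" "bounded E" "C \<in> components E"
  obtains c d where "c < d" "C = {c<..<d}" "c \<notin> E" "d \<notin> E"
proof -
  have C: "open C" "connected C" "C \<noteq> {}" "C \<subseteq> E"
    using assms by (auto simp: open_components in_components_connected in_components_nonempty in_components_subset)
  have bC: "bounded C" using C assms(2) bounded_subset by blast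
  note bdd = bounded_imp_bdd_above[OF bC] bounded_imp_bdd_below[OF bC]
  define c d where "c = Inf C" and "d = Sup C"
  have c: "c \<notin> C"
  proof
    assume "c \<in> C"
    then obtain e where "e > 0" "ball c e \<subseteq> C" using C(1) open_contains_ball by blast
    then have "c - e/2 \<in> C" by (auto simp: subset_iff dist_real_def)
    then have "c \<le> c - e/2" unfolding c_def using bdd by (intro cInf_lower) auto
    with \<open>e > 0\<close> show False by simp
  qed
  have d: "d \<notin> C"
  proof
    assume "d \<in> C"
    then obtain e where "e > 0" "ball d e \<subseteq> C" using C(1) open_contains_ball by blast
    then have "d + e/2 \<in> C" by (auto simp: subset_iff dist_real_def)
    then have "d + e/2 \<le> d" unfolding d_def using bdd by (intro cSup_upper) auto
    with \<open>e > 0\<close> show False by simp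
  qed
  have eq: "C = {c<..<d}"
  proof (intro set_eqI iffI)
    fix x assume x: "x \<in> C"
    then have "c \<le> x" "x \<le> d" unfolding c_def d_def using bdd by (auto intro: cInf_lower cSup_upper)
    with x c d show "x \<in> {c<..<d}" by (auto simp: less_le)
  next
    fix x assume "x \<in> {c<..<d}"
    then obtain y z where "y \<in> C" "y < x" "z \<in> C" "x < z"
      unfolding c_def d_def using bdd C(3) by (auto simp: cInf_less_iff less_cSup_iff)
    then show "x \<in> C" using connectedD_interval[OF C(2), of y z x] by simp
  qed
  obtain x where x: "x \<in> C" using C by auto
  have cd: "c < d" "c < x" "x < d" using x eq by auto
  have "c \<notin> E"
  proof
    assume "c \<in> E"
    moreover have "{c..x} \<subseteq> insert c C" using eq cd by auto
    ultimately have "{c..x} \<subseteq> C"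
      using C x cd by (intro components_maximal[OF assms(3)]) auto
    with c cd show False by (meson atLeastAtMost_iff less_imp_le order_refl subsetD)
  qed
  moreover have "d \<notin> E"
  proof
    assume "d \<in> E"
    moreover have "{x..d} \<subseteq> insert d C" using eq cd by auto
    ultimately have "{x..d} \<subseteq> C"
      using C x cd by (intro components_maximal[OF assms(3)]) auto
    with d cd show False by (meson atLeastAtMost_iff less_imp_le order_refl subsetD)
  qed
  ultimately show ?thesis using that cd eq by blast
qed

text \<open>The components are countably many disjoint open sets, so both measures add up over them.
  This carries an inequality known only on components, as the rising sun lemma provides it, to the
  whole set.\<close>

lemma emeasure_le_of_components:
  fixes E :: "real set"
  assumes E: "open E" "bounded E"
    and sets: "sets M = sets borel" "sets N = sets borel"
    and le: "\<And>c d. c < d \<Longrightarrow> {c<..<d} \<in> components E \<Longrightarrow> c \<notin> E \<Longrightarrow> d \<notin> E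
      \<Longrightarrow> emeasure M {c<..<d} \<le> emeasure N {c<..<d}"
  shows "emeasure M E \<le> emeasure N E"
proof -
  have op: "open C" if "C \<in> components E" for C using that E open_components by blast
  have pw: "pairwise disjnt (components E)"
    using components_nonoverlap by (auto simp: pairwise_def disjnt_def)
  have cnt: "countable (components E)"
    using op pw by (rule countable_disjoint_open_subsets)
  have *: "emeasure P E = (\<integral>\<^sup>+C. emeasure P C \<partial>count_space (components E))"
    if "sets P = sets borel" for P :: "real measure"
  proof -
    have "emeasure P (\<Union>C\<in>components E. C) = (\<integral>\<^sup>+C. emeasure P C \<partial>count_space (components E))"
      using cnt pw op that
      by (intro emeasure_UN_countable) (auto simp: disjoint_family_on_def pairwise_def disjnt_def)
    then show ?thesis using Union_components[of E] by simp
  qed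
  have "emeasure M C \<le> emeasure N C" if "C \<in> components E" for C
    using component_of_bounded_open_real[OF E that] le that by metis
  then show ?thesis unfolding *[OF sets(1)] *[OF sets(2)]
    by (intro nn_integral_mono) auto
qed

text \<open>The shadow points of the rising sun lemma, relative to \<open>V\<close>. Since
  \<open>{x..y}\<close> must stay in \<open>V\<close>, every component of \<open>V\<close> is
  treated on its own and the construction can be iterated inside its own result. For
  \<open>F x - q * x\<close> the condition asks for a chord to the right of slope above
  \<open>q\<close>; \<open>left_steep\<close> for \<open>F x - p * x\<close> asks for a chord to the
  left of slope below \<open>p\<close>.\<close>

definition right_steep :: "(real \<Rightarrow> real) \<Rightarrow> real set \<Rightarrow> real set"
  where "right_steep G V = {x \<in> V. \<exists>y>x. {x..y} \<subseteq> V \<and> G x < G y}"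

definition left_steep :: "(real \<Rightarrow> real) \<Rightarrow> real set \<Rightarrow> real set"
  where "left_steep G V = {x \<in> V. \<exists>y<x. {y..x} \<subseteq> V \<and> G x < G y}"

lemma steep_subset: "right_steep G V \<subseteq> V" "left_steep G V \<subseteq> V"
  by (auto simp: right_steep_def left_steep_def)

text \<open>A witness \<open>y\<close> for \<open>x\<close> also serves nearby points
  \<open>z\<close>: \<open>G z < G y\<close> persists by continuity, and a \<open>z\<close> in the
  component of \<open>x\<close> in \<open>V\<close> is joined to \<open>y\<close> inside
  \<open>V\<close>. So the set is a union of open sets.\<close>

lemma open_steep:
  assumes "open V" "continuous_on UNIV G"
  shows "open (right_steep G V)" "open (left_steep G V)"
proof -
  have op: "open {x. G x < u}" for u
    using open_Collect_less[OF assms(2) continuous_on_const] .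
  have "right_steep G V = (\<Union>x\<in>right_steep G V. \<Union>y\<in>{y. y > x \<and> {x..y} \<subseteq> V}.
      {z. G z < G y} \<inter> ({..<y} \<inter> {z. connected_component V x z} ))" (is "_ = ?R")
  proof (intro equalityI subsetI)
    fix x assume "x \<in> right_steep G V"
    then obtain y where "x \<in> V" "y > x" "{x..y} \<subseteq> V" "G x < G y" by (auto simp: right_steep_def)
    then show "x \<in> ?R" using \<open>x \<in> right_steep G V\<close> by force
  next
    fix z assume "z \<in> ?R"
    then obtain x y where xy: "{x..y} \<subseteq> V" "x < y" "G z < G y" "z < y" "connected_component V x z" by auto
    have "connected_component V x y" unfolding connected_component_def
      using xy by (intro exI[of _ "{x..y}"]) auto
    then have "connected_component V z y"
      using xy(5) connected_component_trans connected_component_sym by metis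
    then obtain S where S: "connected S" "S \<subseteq> V" "z \<in> S" "y \<in> S"
      unfolding connected_component_def by auto
    then have "{z..y} \<subseteq> V" using connectedD_interval[of S z y] by auto
    moreover have "z \<in> V" using S by auto
    ultimately show "z \<in> right_steep G V" using xy by (auto simp: right_steep_def)
  qed
  moreover have "open ?R" using open_connected_component[OF assms(1)] op by (intro open_UN ballI open_Int) auto
  ultimately show "open (right_steep G V)" by simp
  have "left_steep G V = (\<Union>x\<in>left_steep G V. \<Union>y\<in>{y. y < x \<and> {y..x} \<subseteq> V}.
      {z. G z < G y} \<inter> ({y<..} \<inter> {z. connected_component V x z} ))" (is "_ = ?R")
  proof (intro equalityI subsetI)
    fix x assume "x \<in> left_steep G V"
    then obtain y where "x \<in> V" "y < x" "{y..x} \<subseteq> V" "G x < G y" by (auto simp: left_steep_def)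
    then show "x \<in> ?R" using \<open>x \<in> left_steep G V\<close> by force
  next
    fix z assume "z \<in> ?R"
    then obtain x y where xy: "{y..x} \<subseteq> V" "y < x" "G z < G y" "y < z" "connected_component V x z" by auto
    have "connected_component V x y" unfolding connected_component_def
      using xy by (intro exI[of _ "{y..x}"]) auto
    then have "connected_component V z y"
      using xy(5) connected_component_trans connected_component_sym by metis
    then obtain S where S: "connected S" "S \<subseteq> V" "z \<in> S" "y \<in> S"
      unfolding connected_component_def by auto
    then have "{y..z} \<subseteq> V" using connectedD_interval[of S y z] by auto
    moreover have "z \<in> V" using S by auto
    ultimately show "z \<in> left_steep G V" using xy by (auto simp: left_steep_def)
  qed
  moreover have "open ?R" using open_connected_component[OF assms(1)] op by (intro open_UN ballI open_Int) auto
  ultimately show "open (left_steep G V)" by simp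
qed

text \<open>The maximum of \<open>G\<close> over \<open>{x..d}\<close> sits at \<open>d\<close>: if
  it sat at a steep point \<open>z\<close> before \<open>d\<close>, the witness \<open>y\<close> of
  steepness would have to lie beyond \<open>d\<close> and would make \<open>d\<close> steep as well.
  Then \<open>x\<close> tends to \<open>c\<close>.\<close>

lemma rising_sun_right:
  assumes G: "continuous_on UNIV G" and cd: "c < d" "{c<..<d} \<subseteq> right_steep G V" "d \<notin> right_steep G V"
  shows "G c \<le> G d"
proof -
  have le: "G x \<le> G d" if x: "c < x" "x < d" for x
  proof -
    obtain z where z: "z \<in> {x..d}" "\<And>y. y \<in> {x..d} \<Longrightarrow> G y \<le> G z"
      using continuous_attains_sup[of "{x..d}" G] x continuous_on_subset[OF G] by auto
    have "z = d"
    proof (rule ccontr)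
      assume "z \<noteq> d"
      then have "z \<in> right_steep G V" using z x cd by auto
      then obtain y where y: "y > z" "{z..y} \<subseteq> V" "G z < G y" by (auto simp: right_steep_def)
      have "y > d" using z y by (meson atLeastAtMost_iff linorder_not_le order.trans less_imp_le)
      moreover have "G d < G y" using z(2)[of d] x y by fastforce
      ultimately have "d \<in> right_steep G V" using y z by (auto simp: right_steep_def intro!: exI[of _ y])
      with cd show False by blast
    qed
    then show ?thesis using z(2)[of x] x by auto
  qed
  have "(G \<longlongrightarrow> G c) (at_right c)"
    using G by (simp add: continuous_on_eq_continuous_at isCont_def filterlim_at_split)
  moreover have "\<forall>\<^sub>F x in at_right c. G x \<le> G d"
    using le cd by (auto simp: eventually_at_right_field intro!: exI[of _ d])
  ultimately show ?thesis by (rule tendsto_upperbound) auto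
qed

lemma rising_sun_left:
  assumes G: "continuous_on UNIV G" and cd: "c < d" "{c<..<d} \<subseteq> left_steep G V" "c \<notin> left_steep G V"
  shows "G d \<le> G c"
proof -
  have le: "G x \<le> G c" if x: "c < x" "x < d" for x
  proof -
    obtain z where z: "z \<in> {c..x}" "\<And>y. y \<in> {c..x} \<Longrightarrow> G y \<le> G z"
      using continuous_attains_sup[of "{c..x}" G] x continuous_on_subset[OF G] by auto
    have "z = c"
    proof (rule ccontr)
      assume "z \<noteq> c"
      then have "z \<in> left_steep G V" using z x cd by auto
      then obtain y where y: "y < z" "{y..z} \<subseteq> V" "G z < G y" by (auto simp: left_steep_def)
      have "y < c" using z y by (meson atLeastAtMost_iff linorder_not_le order.trans less_imp_le)
      moreover have "G c < G y" using z(2)[of c] x y by fastforce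
      ultimately have "c \<in> left_steep G V" using y z by (auto simp: left_steep_def intro!: exI[of _ y])
      with cd show False by blast
    qed
    then show ?thesis using z(2)[of x] x by auto
  qed
  have "(G \<longlongrightarrow> G d) (at_left d)"
    using G by (simp add: continuous_on_eq_continuous_at isCont_def filterlim_at_split)
  moreover have "\<forall>\<^sub>F x in at_left d. G x \<le> G c"
    using le cd by (auto simp: eventually_at_left_field intro!: exI[of _ c])
  ultimately show ?thesis by (rule tendsto_upperbound) auto
qed

context
  fixes F :: "real \<Rightarrow> real"
  assumes F: "continuous_on UNIV F" "mono F"
begin

lemma emeasure_interval_measure_Ioo:
  assumes "c \<le> d"
  shows "emeasure (interval_measure F) {c<..<d} = ennreal (F d - F c)"
proof -
  have 0: "{d} \<in> null_sets (interval_measure F)"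
    using emeasure_interval_measure_Icc[of d d F] F by (auto simp: null_sets_def mono_def)
  have "emeasure (interval_measure F) ({c<..d} - {d}) = emeasure (interval_measure F) {c<..d}"
    by (rule emeasure_Diff_null_set[OF 0]) auto
  also have "\<dots> = ennreal (F d - F c)"
    using F assms by (intro emeasure_interval_measure_Ioc)
      (auto simp: mono_def continuous_on_eq_continuous_at continuous_at_imp_continuous_at_within)
  also have "{c<..d} - {d} = {c<..<d}" by auto
  finally show ?thesis .
qed

text \<open>On each component the rising sun lemma reads \<open>q * (d - c) \<le> F d - F c\<close>,
  which compares \<open>q\<close> times Lebesgue measure with the Stieltjes measure of
  \<open>F\<close>.\<close>

lemma emeasure_right_steep:
  assumes "open V" "bounded V" "q \<ge> 0"
  defines "E \<equiv> right_steep (\<lambda>x. F x - q * x) V"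
  shows "ennreal q * emeasure lborel E \<le> emeasure (interval_measure F) E"
proof -
  have G: "continuous_on UNIV (\<lambda>x. F x - q * x)" by (intro continuous_intros F)
  have E: "open E" "bounded E"
    unfolding E_def using open_steep[OF assms(1) G] bounded_subset[OF assms(2) steep_subset(1)] by auto
  have "emeasure (scale_measure (ennreal q) lborel) E \<le> emeasure (interval_measure F) E"
  proof (rule emeasure_le_of_components[OF E])
    fix c d :: real assume cd: "c < d" "{c<..<d} \<in> components E" "c \<notin> E" "d \<notin> E"
    have "F c - q * c \<le> F d - q * d"
      using cd by (intro rising_sun_right[OF G, of c d V]) (auto simp: E_def dest: in_components_subset)
    then have "q * (d - c) \<le> F d - F c" by (simp add: algebra_simps)
    then show "emeasure (scale_measure (ennreal q) lborel) {c<..<d} \<le> emeasure (interval_measure F) {c<..<d}"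
      using cd assms(3) by (simp add: emeasure_interval_measure_Ioo ennreal_mult[symmetric] ennreal_leI)
  qed auto
  then show ?thesis by simp
qed

lemma emeasure_left_steep:
  assumes "open V" "bounded V" "p \<ge> 0"
  defines "E \<equiv> left_steep (\<lambda>x. F x - p * x) V"
  shows "emeasure (interval_measure F) E \<le> ennreal p * emeasure lborel E"
proof -
  have G: "continuous_on UNIV (\<lambda>x. F x - p * x)" by (intro continuous_intros F)
  have E: "open E" "bounded E"
    unfolding E_def using open_steep[OF assms(1) G] bounded_subset[OF assms(2) steep_subset(2)] by auto
  have "emeasure (interval_measure F) E \<le> emeasure (scale_measure (ennreal p) lborel) E"
  proof (rule emeasure_le_of_components[OF E])
    fix c d :: real assume cd: "c < d" "{c<..<d} \<in> components E" "c \<notin> E" "d \<notin> E"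
    have "F d - p * d \<le> F c - p * c"
      using cd by (intro rising_sun_left[OF G, of c d V]) (auto simp: E_def dest: in_components_subset)
    then have "F d - F c \<le> p * (d - c)" by (simp add: algebra_simps)
    then show "emeasure (interval_measure F) {c<..<d} \<le> emeasure (scale_measure (ennreal p) lborel) {c<..<d}"
      using cd assms(3) by (simp add: emeasure_interval_measure_Ioo ennreal_mult[symmetric] ennreal_leI)
  qed auto
  then show ?thesis by simp
qed

end

text \<open>Every point whose lower left Dini derivative is below \<open>p\<close> and whose upper
  right one is above \<open>q\<close> belongs to this set. With rational \<open>p\<close> and
  \<open>q\<close>, countably many such sets capture the failure of one inequality between Dini
  derivatives.\<close>

definition oscillation_points :: "(real \<Rightarrow> real) \<Rightarrow> real \<Rightarrow> real \<Rightarrow> real set"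
  where "oscillation_points F p q = {x. \<forall>e>0.
    (\<exists>y. x - e < y \<and> y < x \<and> F x - F y < p * (x - y)) \<and>
    (\<exists>y. x < y \<and> y < x + e \<and> q * (y - x) < F y - F x)}"

text \<open>One \<open>step\<close> passes to left steep points, where the Stieltjes measure is at
  most \<open>p\<close> times Lebesgue measure, and then to right steep points, where it is at least
  \<open>q\<close> times Lebesgue measure. So each step shrinks Lebesgue measure by the factor
  \<open>p / q\<close>, while the oscillation points in an open set survive because their chords
  exist at every scale.\<close>

lemma negligible_oscillation_points:
  assumes F: "continuous_on UNIV F" "mono F" and pq: "0 < p" "p < q"
  shows "negligible (oscillation_points F p q)"
proof -
  define step where "step V = right_steep (\<lambda>x. F x - q * x) (left_steep (\<lambda>x. F x - p * x) V)" for V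
  have Gp: "continuous_on UNIV (\<lambda>x. F x - p * x)" and Gq: "continuous_on UNIV (\<lambda>x. F x - q * x)"
    by (intro continuous_intros F)+
  have op: "open (step V)" if "open V" for V
    unfolding step_def by (intro open_steep that Gp Gq)
  have sub: "step V \<subseteq> V" for V unfolding step_def using steep_subset by blast
  have meas: "emeasure lborel (step V) \<le> ennreal (p / q) * emeasure lborel V" if V: "open V" "bounded V" for V
  proof -
    let ?W = "left_steep (\<lambda>x. F x - p * x) V"
    have W: "open ?W" "bounded ?W" using open_steep[OF V(1) Gp] bounded_subset[OF V(2) steep_subset(2)] by auto
    have "ennreal q * emeasure lborel (step V) \<le> emeasure (interval_measure F) (step V)"
      unfolding step_def using pq by (intro emeasure_right_steep F W) auto
    also have "\<dots> \<le> emeasure (interval_measure F) ?W"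
      unfolding step_def by (intro emeasure_mono steep_subset) (use W in auto)
    also have "\<dots> \<le> ennreal p * emeasure lborel ?W"
      using pq by (intro emeasure_left_steep F V) auto
    also have "\<dots> \<le> ennreal p * emeasure lborel V"
      by (intro mult_left_mono emeasure_mono steep_subset) (use V in auto)
    finally have "ennreal (1/q) * (ennreal q * emeasure lborel (step V)) \<le> ennreal (1/q) * (ennreal p * emeasure lborel V)"
      by (intro mult_left_mono) auto
    then show ?thesis using pq by (simp add: mult.assoc[symmetric] ennreal_mult[symmetric])
  qed
  have "negligible (oscillation_points F p q \<inter> {-real n<..<real n})" for n
  proof -
    define V where "V j = (step ^^ j) {-real n<..<real n}" for j
    have V: "open (V j) \<and> bounded (V j) \<and> emeasure lborel (V j) \<le> ennreal ((p/q)^j * (2 * real n))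
        \<and> oscillation_points F p q \<inter> {-real n<..<real n} \<subseteq> V j" for j
    proof (induction j)
      case 0 show ?case by (auto simp: V_def)
    next
      case (Suc j)
      have eq: "V (Suc j) = step (V j)" by (simp add: V_def)
      have "emeasure lborel (V (Suc j)) \<le> ennreal (p / q) * emeasure lborel (V j)"
        unfolding eq using Suc by (intro meas) auto
      also have "\<dots> \<le> ennreal (p / q) * ennreal ((p/q)^j * (2 * real n))"
        using Suc by (intro mult_left_mono) auto
      also have "\<dots> = ennreal ((p/q)^Suc j * (2 * real n))"
        using pq by (simp add: ennreal_mult[symmetric] mult.assoc)
      finally have "emeasure lborel (V (Suc j)) \<le> \<dots>" .
      moreover have "x \<in> V (Suc j)" if x: "x \<in> oscillation_points F p q" "x \<in> {-real n<..<real n}" for x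
      proof -
        let ?W = "left_steep (\<lambda>x. F x - p * x) (V j)"
        have "x \<in> V j" using Suc x by auto
        then obtain e where e: "e > 0" "ball x e \<subseteq> V j" using Suc open_contains_ball by blast
        obtain y where y: "x - e < y" "y < x" "F x - F y < p * (x - y)"
          using x e unfolding oscillation_points_def by blast
        have "{y..x} \<subseteq> ball x e" using y by (auto simp: dist_real_def)
        then have "x \<in> ?W" using y e \<open>x \<in> V j\<close>
          by (auto simp: left_steep_def algebra_simps intro!: exI[of _ y])
        moreover have "open ?W" using Suc by (intro open_steep Gp) auto
        ultimately obtain e' where e': "e' > 0" "ball x e' \<subseteq> ?W" using open_contains_ball by blast
        obtain y where y: "x < y" "y < x + e'" "q * (y - x) < F y - F x"
          using x e' unfolding oscillation_points_def by blast
        have "{x..y} \<subseteq> ball x e'" using y by (auto simp: dist_real_def)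
        then show ?thesis using y e' \<open>x \<in> ?W\<close> unfolding eq step_def
          by (subst right_steep_def) (auto simp: algebra_simps intro!: exI[of _ y])
      qed
      ultimately show ?case using Suc op[of "V j"] sub[of "V j"] bounded_subset unfolding eq by blast
    qed
    define I where "I = (\<Inter>j. V j)"
    have I: "I \<in> sets borel" unfolding I_def using V by (intro sets.countable_INT) auto
    have le: "emeasure lborel I \<le> ennreal ((p/q)^j * (2 * real n))" for j
    proof -
      have "emeasure lborel I \<le> emeasure lborel (V j)"
        using V by (intro emeasure_mono) (auto simp: I_def)
      with V show ?thesis by (meson order.trans)
    qed
    have "(\<lambda>j. (p/q)^j * (2 * real n)) \<longlonglongrightarrow> 0 * (2 * real n)"
      using pq by (intro tendsto_intros LIMSEQ_power_zero) auto
    then have "(\<lambda>j. ennreal ((p/q)^j * (2 * real n))) \<longlonglongrightarrow> ennreal 0"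
      by (intro tendsto_ennrealI) simp
    then have "emeasure lborel I \<le> ennreal 0"
      using le by (intro LIMSEQ_le_const) auto
    then have "I \<in> null_sets lborel" using I by (auto simp: null_sets_def)
    then have "negligible I"
      using negligible_iff_null_sets null_sets_completionI by blast
    moreover have "oscillation_points F p q \<inter> {-real n<..<real n} \<subseteq> I" using V by (auto simp: I_def)
    ultimately show ?thesis by (rule negligible_subset)
  qed
  then have "negligible (\<Union>n. oscillation_points F p q \<inter> {-real n<..<real n})"
    by (intro negligible_countable_Union) auto
  moreover have "oscillation_points F p q \<subseteq> (\<Union>n. oscillation_points F p q \<inter> {-real n<..<real n})"
  proof
    fix x assume "x \<in> oscillation_points F p q"
    moreover obtain n where "\<bar>x\<bar> < real n" using reals_Archimedean2 by blast
    ultimately show "x \<in> (\<Union>n. oscillation_points F p q \<inter> {-real n<..<real n})" by (auto intro!: exI[of _ n])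
  qed
  ultimately show ?thesis by (rule negligible_subset)
qed


text \<open>Assumption \<open>R\<close> says that the upper right Dini derivative is at most the
  lower left one. Assumption \<open>L\<close>, the same for the reflected function, says that the
  upper left one is at most the lower right one. Together with the trivial inequalities this makes
  all four equal, and the bound on chords makes the common value finite.\<close>

lemma derivative_from_one_sided_quotients:
  fixes F :: "real \<Rightarrow> real"
  assumes mono: "mono F"
    and R: "x \<notin> (\<Union>p\<in>\<rat> \<inter> {0<..}. \<Union>q\<in>\<rat> \<inter> {p<..}. oscillation_points F p q)"
    and L: "- x \<notin> (\<Union>p\<in>\<rat> \<inter> {0<..}. \<Union>q\<in>\<rat> \<inter> {p<..}. oscillation_points (\<lambda>x. - F (- x)) p q)"
    and s: "x < b" "\<And>y. x < y \<Longrightarrow> y < b \<Longrightarrow> F y - F x \<le> s * (y - x)"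
  obtains D where "D \<le> s" "(F has_real_derivative D) (at x)"
proof -
  define Q where "Q y = (F y - F x) / (y - x)" for y
  \<comment> \<open>The first letter names the side of \<open>x\<close>; the second is
    \<open>U\<close> for an eventual upper bound of the difference quotient and \<open>L\<close> for
    an eventual lower bound.\<close>
  define RU where "RU q \<longleftrightarrow> (\<forall>\<^sub>F y in at_right x. Q y \<le> q)" for q
  define RL where "RL q \<longleftrightarrow> (\<forall>\<^sub>F y in at_right x. q \<le> Q y)" for q
  define LU where "LU q \<longleftrightarrow> (\<forall>\<^sub>F y in at_left x. Q y \<le> q)" for q
  define LL where "LL q \<longleftrightarrow> (\<forall>\<^sub>F y in at_left x. q \<le> Q y)" for q
  have mon: "F a \<le> F b" if "a \<le> b" for a b using mono that by (auto simp: mono_def)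
  have Q0: "0 \<le> Q y" for y
    using mon[of x y] mon[of y x] unfolding Q_def
    by (cases "x \<le> y") (auto simp: divide_nonneg_nonneg divide_nonpos_nonpos)
  have h1: "LL p \<or> RU q" if pq: "0 < p" "p < q" for p q
  proof -
    obtain p' where p': "p' \<in> \<rat>" "p < p'" "p' < q" using Rats_dense_in_real pq by blast
    obtain q' where q': "q' \<in> \<rat>" "p' < q'" "q' < q" using Rats_dense_in_real p' by blast
    have "x \<notin> oscillation_points F p' q'" using R p' q' pq by auto
    then obtain e where e: "e > 0" "\<not> ((\<exists>y. x - e < y \<and> y < x \<and> F x - F y < p' * (x - y)) \<and>
        (\<exists>y. x < y \<and> y < x + e \<and> q' * (y - x) < F y - F x))"
      unfolding oscillation_points_def by blast
    from e(2) have e2: "(\<forall>y. x - e < y \<and> y < x \<longrightarrow> p' * (x - y) \<le> F x - F y) \<or>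
        (\<forall>y. x < y \<and> y < x + e \<longrightarrow> F y - F x \<le> q' * (y - x))"
      by (meson not_le)
    show ?thesis
    proof (cases "\<forall>y. x - e < y \<and> y < x \<longrightarrow> p' * (x - y) \<le> F x - F y")
      case True
      have "p \<le> Q y" if "x - e < y" "y < x" for y
      proof -
        have "p * (x - y) \<le> p' * (x - y)" using that p' by (intro mult_right_mono) auto
        moreover have "p' * (x - y) \<le> F x - F y" using True[rule_format, of y] that by simp
        ultimately have "p * (x - y) \<le> F x - F y" by linarith
        then show ?thesis using that by (auto simp: Q_def field_simps)
      qed
      then show ?thesis using e unfolding LL_def eventually_at_left_field
        by (intro disjI1 exI[of _ "x - e"]) auto
    next
      case False
      with e2 have *: "\<forall>y. x < y \<and> y < x + e \<longrightarrow> F y - F x \<le> q' * (y - x)" by simp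
      have "Q y \<le> q" if "y < x + e" "x < y" for y
      proof -
        have "q' * (y - x) \<le> q * (y - x)" using that q' by (intro mult_right_mono) auto
        moreover have "F y - F x \<le> q' * (y - x)" using *[rule_format, of y] that by simp
        ultimately have "F y - F x \<le> q * (y - x)" by linarith
        then show ?thesis using that by (auto simp: Q_def field_simps)
      qed
      then show ?thesis using e unfolding RU_def eventually_at_right_field
        by (intro disjI2 exI[of _ "x + e"]) auto
    qed
  qed
  have h2: "RL p \<or> LU q" if pq: "0 < p" "p < q" for p q
  proof -
    obtain p' where p': "p' \<in> \<rat>" "p < p'" "p' < q" using Rats_dense_in_real pq by blast
    obtain q' where q': "q' \<in> \<rat>" "p' < q'" "q' < q" using Rats_dense_in_real p' by blast
    have "- x \<notin> oscillation_points (\<lambda>x. - F (- x)) p' q'" using L p' q' pq by auto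
    then obtain e where e: "e > 0" "\<not> ((\<exists>y. - x - e < y \<and> y < - x \<and> - F (- (- x)) - - F (- y) < p' * (- x - y)) \<and>
        (\<exists>y. - x < y \<and> y < - x + e \<and> q' * (y - - x) < - F (- y) - - F (- (- x))))"
      unfolding oscillation_points_def by blast
    from e(2) have e2: "(\<forall>y. - x - e < y \<and> y < - x \<longrightarrow> p' * (- x - y) \<le> F (- y) - F x) \<or>
        (\<forall>y. - x < y \<and> y < - x + e \<longrightarrow> F x - F (- y) \<le> q' * (y + x))"
      by (simp add: not_less) (meson not_less)
    show ?thesis
    proof (cases "\<forall>y. - x - e < y \<and> y < - x \<longrightarrow> p' * (- x - y) \<le> F (- y) - F x")
      case True
      have "p \<le> Q y" if "y < x + e" "x < y" for y
      proof -
        have "p * (y - x) \<le> p' * (y - x)" using that p' by (intro mult_right_mono) auto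
        moreover have "p' * (y - x) \<le> F y - F x" using True[rule_format, of "- y"] that by auto
        ultimately have "p * (y - x) \<le> F y - F x" by linarith
        then show ?thesis using that by (auto simp: Q_def field_simps)
      qed
      then show ?thesis using e unfolding RL_def eventually_at_right_field
        by (intro disjI1 exI[of _ "x + e"]) auto
    next
      case False
      with e2 have *: "\<forall>y. - x < y \<and> y < - x + e \<longrightarrow> F x - F (- y) \<le> q' * (y + x)" by simp
      have "Q y \<le> q" if "x - e < y" "y < x" for y
      proof -
        have "q' * (x - y) \<le> q * (x - y)" using that q' by (intro mult_right_mono) auto
        moreover have "F x - F y \<le> q' * (x - y)" using *[rule_format, of "- y"] that by auto
        ultimately have "F x - F y \<le> q * (x - y)" by linarith
        then show ?thesis using that by (auto simp: Q_def field_simps)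
      qed
      then show ?thesis using e unfolding LU_def eventually_at_left_field
        by (intro disjI2 exI[of _ "x - e"]) auto
    qed
  qed
  have clashR: False if "RL p" "RU q" "q < p" for p q
  proof -
    have "\<forall>\<^sub>F y in at_right x. False"
      using that(1,2) unfolding RL_def RU_def by eventually_elim (use that(3) in auto)
    then show False by simp
  qed
  have clashL: False if "LL p" "LU q" "q < p" for p q
  proof -
    have "\<forall>\<^sub>F y in at_left x. False"
      using that(1,2) unfolding LL_def LU_def by eventually_elim (use that(3) in auto)
    then show False by simp
  qed
  have pos: "0 \<le> q" if "RU q" for q
  proof (rule ccontr)
    assume "\<not> 0 \<le> q"
    moreover have "RL 0" using Q0 by (simp add: RL_def)
    ultimately show False using clashR[of 0 q] that by auto
  qed
  have "Q y \<le> s" if "x < y" "y < b" for y using s(2)[OF that] that by (simp add: Q_def pos_divide_le_eq)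
  then have RUs: "RU s" unfolding RU_def eventually_at_right_field using s(1) by (intro exI[of _ b]) auto
  \<comment> \<open>The upper right Dini derivative, finite because \<open>s\<close> is one of the
    bounds.\<close>
  define D where "D = Inf {q. RU q}"
  have bdd: "bdd_below {q. RU q}" using pos by (auto simp: bdd_below_def)
  have D0: "0 \<le> D" unfolding D_def using RUs pos by (intro cInf_greatest) auto
  have Ds: "D \<le> s" unfolding D_def using RUs bdd by (intro cInf_lower) auto
  have above: "\<exists>r<q. RU r" if "D < q" for q
    using that cInf_lessD[of "{q. RU q}" q] RUs unfolding D_def by auto
  have below: "\<not> RU q" if "q < D" for q
    using that cInf_lower[OF _ bdd, of q] unfolding D_def by auto
  have "(Q \<longlongrightarrow> D) (at x)"
  proof (rule order_tendstoI)
    fix a assume a: "a < D"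
    show "\<forall>\<^sub>F y in at x. a < Q y"
    proof (cases "a < 0")
      case True
      then have "a < Q y" for y using Q0[of y] by linarith
      then show ?thesis by simp
    next
      case False
      \<comment> \<open>No number below \<open>D\<close> is an upper bound on the right, so
        \<open>h1\<close> gives the lower bounds \<open>p\<close> and \<open>q'\<close> on the left.
        The second rules out the upper bound \<open>q\<close> there, and \<open>h2\<close> then
        yields the lower bound \<open>p\<close> on the right.\<close>
      obtain p q q' where pq: "a < p" "p < q" "q < q'" "q' < D" using a dense by metis
      have l: "LL p" "LL q'" using h1[of p q] h1[of q' "(q' + D)/2"] below[of q] below[of "(q' + D)/2"] pq False by auto
      have r: "RL p" using h2[of p q] clashL[of q' q] l pq False by auto
      show ?thesis unfolding eventually_at_split
        using l(1) r pq(1) unfolding LL_def RL_def by (auto elim!: eventually_mono)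
    qed
  next
    fix a assume a: "D < a"
    obtain p q where pq: "D < p" "p < q" "q < a" using a dense by metis
    obtain r where r: "r < p" "RU r" using above pq(1) by auto
    have "LU q" using h2[of p q] clashR[of p r] r pq D0 by auto
    then show "\<forall>\<^sub>F y in at x. Q y < a" unfolding eventually_at_split
      using r pq unfolding LU_def RU_def by (auto elim!: eventually_mono)
  qed
  then have "(F has_real_derivative D) (at x)"
    unfolding has_field_derivative_iff Q_def .
  with Ds show ?thesis by (rule that)
qed

text \<open>
  No differentiability is assumed: the conclusion holds because, at almost every point where no
  chord to the right has slope above \<open>s\<close>, the function is differentiable with derivative at most
  \<open>s\<close>.
\<close>

lemma mono_increment_ge:
  fixes F :: "real \<Rightarrow> real"
  assumes F: "continuous_on UNIV F" "mono F" and Z: "negligible Z" and ab: "a \<le> b"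
    and D: "\<And>t D. a < t \<Longrightarrow> t < b \<Longrightarrow> t \<notin> Z \<Longrightarrow> (F has_real_derivative D) (at t) \<Longrightarrow> r \<le> D"
  shows "r * (b - a) \<le> F b - F a"
proof (rule ccontr)
  assume neg: "\<not> ?thesis"
  then have ab': "a < b" using ab by (cases "a = b") auto
  have mon: "F a \<le> F b" using F(2) ab by (auto simp: mono_def)
  have "(F b - F a) / (b - a) < r" using neg ab' by (simp add: field_simps)
  then obtain s where s: "(F b - F a) / (b - a) < s" "s < r" using dense by blast
  have s0: "0 \<le> s" using s(1) mon ab' by (smt (verit) divide_nonneg_nonneg)
  have s1: "F b - F a < s * (b - a)" using s(1) ab' by (simp add: field_simps)
  \<comment> \<open>Points from which some chord to the right inside \<open>{a<..<b}\<close> has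
    slope above \<open>s\<close>. As \<open>s\<close> exceeds the mean slope of \<open>F\<close>,
    the measure comparison prevents \<open>E\<close> from having full measure. This leaves a point
    outside all exceptional sets, where the derivative exists and is at most
    \<open>s < r\<close>.\<close>
  define E where "E = right_steep (\<lambda>x. F x - s * x) {a<..<b}"
  have Eo: "open E" unfolding E_def by (intro open_steep continuous_intros F)
  have Esub: "E \<subseteq> {a<..<b}" unfolding E_def by (rule steep_subset)
  have "ennreal s * emeasure lborel E \<le> emeasure (interval_measure F) E"
    unfolding E_def using s0 by (intro emeasure_right_steep F) auto
  also have "\<dots> \<le> emeasure (interval_measure F) {a<..<b}" using Esub by (intro emeasure_mono) auto
  also have "\<dots> = ennreal (F b - F a)" using F ab by (rule emeasure_interval_measure_Ioo)
  also have "\<dots> < ennreal (s * (b - a))" using s1 mon by (intro ennreal_lessI) auto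
  also have "\<dots> = ennreal s * emeasure lborel {a<..<b}" using s0 ab by (simp add: ennreal_mult)
  finally have lt: "emeasure lborel E \<noteq> emeasure lborel {a<..<b}" by auto
  define Osc where "Osc F = (\<Union>p\<in>\<rat> \<inter> {0<..}. \<Union>q\<in>\<rat> \<inter> {p<..}. oscillation_points F p q)" for F
  have Osc: "negligible (Osc G)" if "continuous_on UNIV G" "mono G" for G
  proof -
    have "countable (\<rat> \<inter> {p<..} :: real set)" for p by (intro countable_Int1 countable_rat)
    then show ?thesis unfolding Osc_def
      by (intro negligible_countable_Union countable_image ballI)
        (auto intro!: negligible_countable_Union negligible_oscillation_points[OF that])
  qed
  have N1: "negligible (Osc F)" by (rule Osc[OF F])
  have "negligible (Osc (\<lambda>x. - F (- x)))"
    using F(2) by (intro Osc continuous_intros continuous_on_compose2[OF F(1)]) (auto simp: mono_def)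
  then have N2: "negligible (uminus ` Osc (\<lambda>x. - F (- x)))"
    by (intro negligible_differentiable_image_negligible differentiable_on_minus differentiable_on_ident) simp_all
  have "\<not> {a<..<b} - E \<subseteq> Z \<union> Osc F \<union> uminus ` Osc (\<lambda>x. - F (- x))"
  proof
    assume "{a<..<b} - E \<subseteq> Z \<union> Osc F \<union> uminus ` Osc (\<lambda>x. - F (- x))"
    then have "negligible ({a<..<b} - E)"
      by (rule negligible_subset[rotated]) (intro negligible_Un Z N1 N2)
    then have "emeasure lebesgue ({a<..<b} - E) = 0"
      by (auto simp: negligible_iff_null_sets null_sets_def)
    then have 0: "emeasure lborel ({a<..<b} - E) = 0"
      using Eo by (subst (asm) emeasure_completion) auto
    have "emeasure lborel (E \<union> ({a<..<b} - E)) = emeasure lborel E + emeasure lborel ({a<..<b} - E)"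
      using Eo by (intro plus_emeasure[symmetric]) auto
    moreover have "E \<union> ({a<..<b} - E) = {a<..<b}" using Esub by auto
    ultimately show False using lt 0 by simp
  qed
  then obtain x where x0: "x \<in> {a<..<b} - E" "x \<notin> Z \<union> Osc F \<union> uminus ` Osc (\<lambda>x. - F (- x))"
    by blast
  have "- x \<notin> Osc (\<lambda>x. - F (- x))"
    using x0(2) by (metis UnI2 image_eqI minus_minus)
  with x0 have x: "a < x" "x < b" "x \<notin> E" "x \<notin> Z" "x \<notin> Osc F" "- x \<notin> Osc (\<lambda>x. - F (- x))"
    by simp_all
  have "F y - F x \<le> s * (y - x)" if "x < y" "y < b" for y
  proof (rule ccontr)
    assume "\<not> ?thesis"
    then have "F x - s * x < F y - s * y" by (simp add: algebra_simps)
    with x that have "x \<in> E" unfolding E_def right_steep_def by (auto intro!: exI[of _ y])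
    with x show False by simp
  qed
  then obtain D' where "D' \<le> s" "(F has_real_derivative D') (at x)"
    using derivative_from_one_sided_quotients[OF F(2) x(5,6)[unfolded Osc_def] x(2)] by metis
  with D[of x D'] x s show False by auto
qed

section \<open>Inverse branches\<close>

lemma dist_to_circle_le: "dist (to_circle x) (to_circle y) \<le> \<bar>x - y\<bar>"
  using round_diff_minimal[of "x - y" 0] by (simp add: dist_to_circle)

lemma dist_to_circle_eq:
  assumes "\<bar>x - y\<bar> \<le> 1 / 2"
  shows "dist (to_circle x) (to_circle y) = \<bar>x - y\<bar>"
proof (rule antisym[OF dist_to_circle_le])
  let ?n = "round (x - y)"
  show "\<bar>x - y\<bar> \<le> dist (to_circle x) (to_circle y)"
  proof (cases "?n = 0")
    case False
    then have "1 \<le> \<bar>real_of_int ?n\<bar>" by linarith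
    then show ?thesis using assms unfolding dist_to_circle by linarith
  qed (simp add: dist_to_circle)
qed

lemma ex_near_representative:
  obtains v where "to_circle v = q" "\<bar>u - v\<bar> = dist (to_circle u) q"
proof -
  obtain w where w: "to_circle w = q" using to_circle_surj by blast
  define v where "v = w + of_int (round (u - w))"
  have "to_circle v = to_circle w" unfolding to_circle_eq_iff v_def by simp
  with w have "to_circle v = q" by simp
  moreover have "\<bar>u - v\<bar> = dist (to_circle u) q"
    unfolding w[symmetric] dist_to_circle v_def by (simp add: algebra_simps)
  ultimately show ?thesis by (rule that)
qed

lemma continuous_on_to_circle: "continuous_on S to_circle"
  by (rule continuous_onI) (metis dist_to_circle_le dist_real_def order_le_less_trans order_less_imp_le)

text \<open>\<open>E\<close> identifies the circle with the complex unit circle. On the contractible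
  line the nonvanishing function \<open>E (T (to_circle t))\<close> has a continuous logarithm, and
  its imaginary part divided by \<open>2 * pi\<close> is a lift.\<close>

lemma circle_lift_exists:
  assumes "continuous_on UNIV T"
  shows "\<exists>F. circle_lift T F"
proof -
  define rep where "rep p = (SOME t. to_circle t = p)" for p
  define E where "E p = cis (2 * pi * rep p)" for p
  have E: "E (to_circle t) = cis (2 * pi * t)" for t
  proof -
    have "to_circle (rep (to_circle t)) = to_circle t"
      unfolding rep_def by (rule someI[of _ t]) simp
    then obtain n where n: "rep (to_circle t) - t = of_int n"
      unfolding to_circle_eq_iff by (elim Ints_cases)
    then have "rep (to_circle t) = t + of_int n" by simp
    then have "E (to_circle t) = cis (2 * pi * t + 2 * pi * of_int n)"
      unfolding E_def by (simp add: algebra_simps)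
    also have "\<dots> = cis (2 * pi * t) * cis (2 * pi * of_int n)" by (rule cis_mult[symmetric])
    also have "cis (2 * pi * of_int n) = 1" by (rule cis_multiple_2pi) simp
    finally show ?thesis by simp
  qed
  have contE: "continuous_on UNIV E"
    unfolding continuous_on_iff
  proof (intro ballI allI impI)
    fix p :: circle and e :: real assume "e > 0"
    obtain u where u: "to_circle u = p" using to_circle_surj by blast
    have "isCont (\<lambda>t. exp (\<i> * complex_of_real (2 * pi * t))) u" by (intro continuous_intros)
    then have "isCont (\<lambda>t. cis (2 * pi * t)) u" by (simp add: cis_conv_exp)
    then obtain d where d: "d > 0" "\<And>v. dist v u < d \<Longrightarrow> dist (cis (2 * pi * v)) (cis (2 * pi * u)) < e"
      using \<open>e > 0\<close> unfolding continuous_at_eps_delta dist_norm by (metis dist_norm)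
    have "dist (E q) (E p) < e" if q: "dist q p < d" for q
    proof -
      obtain v where v: "to_circle v = q" "\<bar>u - v\<bar> = dist (to_circle u) q"
        by (rule ex_near_representative)
      then have "dist v u < d" using q u by (simp add: dist_commute dist_real_def abs_minus_commute)
      then show ?thesis using d(2) E u v(1) by metis
    qed
    with d(1) show "\<exists>d>0. \<forall>q\<in>UNIV. dist q p < d \<longrightarrow> dist (E q) (E p) < e" by blast
  qed
  have "continuous_on UNIV (\<lambda>t. E (T (to_circle t)))"
    by (intro continuous_on_compose2[OF contE] continuous_on_compose2[OF assms] continuous_on_to_circle) auto
  then obtain g where g: "continuous_on UNIV g" "\<And>t. E (T (to_circle t)) = exp (g t)"
    by (rule continuous_logarithm_on_contractible)
      (auto simp: E_def intro: convex_imp_contractible)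
  have "T (to_circle t) = to_circle (Im (g t) / (2 * pi))" for t
  proof -
    obtain s where s: "to_circle s = T (to_circle t)" using to_circle_surj by blast
    have "exp (g t) = exp (\<i> * complex_of_real (2 * pi * s))"
      using g(2)[of t] E[of s] s by (simp add: cis_conv_exp)
    then obtain n :: int where "g t = \<i> * complex_of_real (2 * pi * s) + (of_int (2 * n) * pi) * \<i>"
      unfolding exp_eq by auto
    then have "Im (g t) = 2 * pi * (s + of_int n)" by (simp add: algebra_simps)
    then have "Im (g t) / (2 * pi) = s + of_int n" by (simp add: field_simps)
    then have "to_circle (Im (g t) / (2 * pi)) = to_circle s" by (simp add: to_circle_eq_iff)
    with s show ?thesis by simp
  qed
  moreover have "continuous_on UNIV (\<lambda>t. Im (g t) / (2 * pi))" by (intro continuous_intros g) auto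
  ultimately show ?thesis unfolding circle_lift_def by blast
qed

text \<open>The increment of \<open>F\<close> over a period is continuous and integer valued, hence
  a constant \<open>m\<close>, the signed degree.\<close>

lemma circle_lift_degree:
  assumes "circle_lift T F"
  obtains m :: int where "\<And>t i. F (t + of_int i) = F t + of_int (i * m)"
proof -
  have cont: "continuous_on UNIV F" and lift: "\<And>t. T (to_circle t) = to_circle (F t)"
    using assms by (auto simp: circle_lift_def)
  have int: "F (t + 1) - F t \<in> \<int>" for t
  proof -
    have "to_circle (t + 1) = to_circle t" by (simp add: to_circle_eq_iff)
    then show ?thesis using lift by (metis to_circle_eq_iff)
  qed
  have "(\<lambda>t. F (t + 1) - F t) constant_on UNIV"
  proof (rule continuous_discrete_range_constant)
    show "continuous_on UNIV (\<lambda>t. F (t + 1) - F t)"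
      by (intro continuous_intros cont continuous_on_compose2[OF cont]) auto
    fix x :: real
    have "1 \<le> norm ((F (y + 1) - F y) - (F (x + 1) - F x))"
      if "F (y + 1) - F y \<noteq> F (x + 1) - F x" for y
      using that Ints_nonzero_abs_ge1[OF Ints_diff[OF int[of y] int[of x]]] by auto
    then show "\<exists>e>0. \<forall>y. y \<in> UNIV \<and> F (y + 1) - F y \<noteq> F (x + 1) - F x \<longrightarrow>
        e \<le> norm (F (y + 1) - F y - (F (x + 1) - F x))" by (intro exI[of _ 1]) auto
  qed auto
  then obtain c where c: "\<And>t. F (t + 1) - F t = c" by (auto simp: constant_on_def)
  with int obtain m where m: "c = of_int m" by (metis Ints_cases)
  have step: "F (t + 1) = F t + of_int m" for t using c[of t] m by simp
  have "F (t + of_int i) = F t + of_int (i * m)" for t i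
  proof (induction i rule: int_induct[where k = 0])
    case (step1 i) then show ?case using step[of "t + of_int i"] by (simp add: algebra_simps)
  next
    case (step2 i) then show ?case using step[of "t + of_int (i - 1)"] by (simp add: algebra_simps)
  qed simp
  then show ?thesis by (rule that)
qed

lemma covering_space_locally_inj:
  assumes "covering_space UNIV T UNIV"
  obtains e where "e > 0" "inj_on T (ball (p :: 'a :: metric_space) e)"
proof -
  obtain V where V: "T p \<in> V" "\<exists>v. \<Union>v = UNIV \<inter> T -` V \<and>
      (\<forall>u\<in>v. openin (top_of_set UNIV) u) \<and> pairwise disjnt v \<and> (\<forall>u\<in>v. \<exists>q. homeomorphism u V T q)"
    using assms unfolding covering_space_def by blast
  then obtain v where v: "\<Union>v = T -` V" "\<forall>u\<in>v. open u" "\<forall>u\<in>v. \<exists>q. homeomorphism u V T q" by auto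
  then obtain u q where u: "p \<in> u" "open u" "homeomorphism u V T q" using V(1) by blast
  have "inj_on T u" using u(3) by (metis homeomorphism_def inj_on_inverseI)
  moreover obtain e where "e > 0" "ball p e \<subseteq> u" using u open_contains_ball by blast
  ultimately show ?thesis using that inj_on_subset by blast
qed

text \<open>Local injectivity makes \<open>F\<close> strictly monotone near each point, which
  excludes interior extrema. Between two points of equal value both extrema would then be at the
  ends, so \<open>F\<close> would be constant there and every interior point an extremum.\<close>

lemma inj_of_locally_inj_real:
  fixes F :: "real \<Rightarrow> real"
  assumes cont: "continuous_on UNIV F" and loc: "\<And>t. \<exists>e>0. inj_on F (ball t e)"
  shows "inj F"
proof (rule ccontr)
  assume "\<not> inj F"
  then obtain a b where ab: "a < b" "F a = F b"
    unfolding inj_on_def by (metis linorder_less_linear)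
  have c: "continuous_on {a..b} F" using cont continuous_on_subset by blast
  have no_ext: False if z: "a < z" "z < b"
    and ext: "(\<forall>y\<in>{a..b}. F y \<le> F z) \<or> (\<forall>y\<in>{a..b}. F z \<le> F y)" for z
  proof -
    obtain e where e: "e > 0" "inj_on F (ball z e)" using loc by blast
    define d where "d = min (e / 2) (min (z - a) (b - z))"
    have d: "d > 0" "a \<le> z - d" "z + d \<le> b" "{z - d..z + d} \<subseteq> ball z e"
      using e z by (auto simp: d_def dist_real_def)
    have "(F (z - d) < F z \<and> F z < F (z + d)) \<or> (F (z + d) < F z \<and> F z < F (z - d))"
      using d e cont by (intro continuous_inj_imp_mono) (auto intro: continuous_on_subset inj_on_subset)
    moreover have "z - d \<in> {a..b}" "z + d \<in> {a..b}" using d z by auto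
    ultimately show False using ext by (meson not_less)
  qed
  obtain u where u: "u \<in> {a..b}" "\<forall>y\<in>{a..b}. F y \<le> F u"
    using continuous_attains_sup[of "{a..b}" F] c ab by auto
  obtain w where w: "w \<in> {a..b}" "\<forall>y\<in>{a..b}. F w \<le> F y"
    using continuous_attains_inf[of "{a..b}" F] c ab by auto
  have "u = a \<or> u = b" "w = a \<or> w = b" using no_ext[of u] no_ext[of w] u w by fastforce+
  then have const: "F y = F a" if "y \<in> {a..b}" for y
    using u(2) w(2) that ab(2) by (metis order_antisym)
  have z: "a < (a + b) / 2" "(a + b) / 2 < b" using ab by auto
  then have "F ((a + b) / 2) = F a" by (intro const) auto
  then have "\<forall>y\<in>{a..b}. F y \<le> F ((a + b) / 2)" using const by (metis order_refl)
  then show False using no_ext[OF z] by blast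
qed

lemma inj_circle_lift:
  assumes cov: "covering_space UNIV T UNIV" and F: "circle_lift T F"
  shows "inj F"
proof (rule inj_of_locally_inj_real)
  show "continuous_on UNIV F" using F by (simp add: circle_lift_def)
  fix t
  obtain e where e: "e > 0" "inj_on T (ball (to_circle t) e)"
    using covering_space_locally_inj[OF cov] by metis
  \<comment> \<open>Radius 1/4 keeps two points of the ball within 1/2 of each other, where
    \<open>to_circle\<close> is injective.\<close>
  have "inj_on F (ball t (min e (1/4)))"
  proof (rule inj_onI)
    fix x y assume x: "x \<in> ball t (min e (1/4))" and y: "y \<in> ball t (min e (1/4))" and eq: "F x = F y"
    have "to_circle z \<in> ball (to_circle t) e" if "z \<in> ball t (min e (1/4))" for z
      using that dist_to_circle_le[of t z] by (simp add: dist_real_def)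
    then have "to_circle x = to_circle y"
      using e(2) x y eq F unfolding circle_lift_def inj_on_def by metis
    moreover have "\<bar>x - y\<bar> \<le> 1 / 2"
    proof -
      have "\<bar>t - x\<bar> < 1 / 4" "\<bar>t - y\<bar> < 1 / 4" using x y by (auto simp: dist_real_def)
      then show ?thesis by linarith
    qed
    ultimately show "x = y" using dist_to_circle_eq[of x y] by simp
  qed
  with e(1) show "\<exists>e>0. inj_on F (ball t e)" by (intro exI[of _ "min e (1/4)"]) auto
qed

section \<open>Expansion of a lift and enumeration of fibres\<close>

locale expanding_lift =
  fixes T :: "circle \<Rightarrow> circle" and F :: "real \<Rightarrow> real"
  assumes cov: "covering_space UNIV T UNIV" and lift: "circle_lift T F"
    and expanding: "uniformly_expanding_away_from T 0"
begin

lemma cont: "continuous_on UNIV F" using lift by (simp add: circle_lift_def)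
lemma T_eq: "T (to_circle t) = to_circle (F t)" using lift by (simp add: circle_lift_def)

text \<open>The covering may reverse orientation. This sign makes the lift increasing, as the
  increment estimate for monotone functions requires.\<close>

definition orientation :: real where "orientation = (if strict_mono F then 1 else -1)"

definition G where "G t = orientation * F t"

lemma abs_G_diff: "\<bar>G a - G b\<bar> = \<bar>F a - F b\<bar>"
  by (auto simp: G_def orientation_def)

lemma strict_mono_G: "strict_mono G"
proof -
  have "strict_mono F \<or> strict_antimono_on UNIV F"
    using injective_eq_monotone_map[OF is_interval_univ cont] inj_circle_lift[OF cov lift]
    by auto
  then show ?thesis unfolding G_def orientation_def by (auto simp: strict_mono_def monotone_on_def)
qed

lemma cont_G: "continuous_on UNIV G"
  unfolding G_def by (intro continuous_intros cont)

lemma mono_G: "mono G" using strict_mono_G by (rule strict_mono_mono)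

lemma derivative_G_ge:
  assumes "(G has_real_derivative D) (at t)"
    and r: "\<And>x D. x \<notin> N \<Longrightarrow> has_circle_derivative T D x (\<lambda>t. at t) \<Longrightarrow> r \<le> \<bar>D\<bar>"
    and "to_circle t \<notin> N"
  shows "r \<le> D"
proof -
  have o: "orientation * orientation = 1" "\<bar>orientation\<bar> = 1" by (auto simp: orientation_def)
  have F: "(\<lambda>t. orientation * G t) = F"
    unfolding G_def mult.assoc[symmetric] o by simp
  have "(F has_real_derivative orientation * D) (at t)"
    using DERIV_cmult[OF assms(1), of orientation] unfolding F .
  then have "has_circle_derivative T (orientation * D) (to_circle t) (\<lambda>t. at t)"
    using lift unfolding has_circle_derivative_def by blast
  with r assms(3) have "r \<le> \<bar>orientation * D\<bar>" by blast
  also have "\<dots> = \<bar>D\<bar>" using o by (simp add: abs_mult)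
  also have "0 \<le> D"
    using mono_on_imp_deriv_nonneg[of UNIV G D t] assms(1) mono_G by simp
  then have "\<bar>D\<bar> = D" by simp
  finally show ?thesis .
qed

text \<open>Every non-integer \<open>t\<close> lies outside a ball around \<open>0\<close> whose
  radius depends on \<open>t\<close>, so a derivative there exceeds 1, though with no uniform
  margin. The integers are absorbed by the negligible set allowed in
  \<open>mono_increment_ge\<close>.\<close>

lemma G_weak_expansion:
  assumes "a \<le> b"
  shows "b - a \<le> G b - G a"
proof -
  have "1 * (b - a) \<le> G b - G a"
  proof (rule mono_increment_ge[OF cont_G mono_G _ assms])
    show "negligible (\<int> :: real set)"
      by (simp add: negligible_iff_null_sets countable_int countable_imp_null_set_lborel null_sets_completionI)
    fix t D assume t: "t \<notin> \<int>" and D: "(G has_real_derivative D) (at t)"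
    have "to_circle t \<noteq> 0" using t by (simp add: zero_circle_eq to_circle_eq_iff)
    then have d: "0 < dist (to_circle t) 0" by simp
    define N where "N = ball (0 :: circle) (dist (to_circle t) 0)"
    have "0 \<in> interior N" unfolding N_def using d by simp
    then obtain r where r: "r > 1" "\<And>x D. x \<notin> N \<Longrightarrow> has_circle_derivative T D x (\<lambda>t. at t) \<Longrightarrow> r \<le> \<bar>D\<bar>"
      using expanding unfolding uniformly_expanding_away_from_def by blast
    have "to_circle t \<notin> N" by (simp add: N_def dist_commute)
    with D r(2) have "r \<le> D" by (rule derivative_G_ge)
    with r show "1 \<le> D" by simp
  qed
  then show ?thesis by simp
qed

lemma G_strong_expansion:
  assumes "e > 0"
  obtains r where "r > 1"
    "\<And>a b. a \<le> b \<Longrightarrow> (\<And>t. a < t \<Longrightarrow> t < b \<Longrightarrow> e \<le> dist (to_circle t) 0) \<Longrightarrow> r * (b - a) \<le> G b - G a"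
proof -
  have "0 \<in> interior (ball (0 :: circle) e)" using assms by simp
  then obtain r where r: "r > 1"
      "\<And>x D. x \<notin> ball 0 e \<Longrightarrow> has_circle_derivative T D x (\<lambda>t. at t) \<Longrightarrow> r \<le> \<bar>D\<bar>"
    using expanding unfolding uniformly_expanding_away_from_def by blast
  have "r * (b - a) \<le> G b - G a"
    if "a \<le> b" and far: "\<And>t. a < t \<Longrightarrow> t < b \<Longrightarrow> e \<le> dist (to_circle t) 0" for a b
  proof (rule mono_increment_ge[OF cont_G mono_G negligible_empty \<open>a \<le> b\<close>])
    fix t D assume "a < t" "t < b" and D: "(G has_real_derivative D) (at t)"
    then have "to_circle t \<notin> ball 0 e" using far[of t] by (simp add: dist_commute)
    with D r(2) show "r \<le> D" by (rule derivative_G_ge)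
  qed
  with r(1) that show ?thesis by blast
qed

text \<open>If an endpoint lies outside the \<eta>-ball, the part of the interval within
  \<open>l = \<eta> * (b - a)\<close> of it stays at distance at least \<eta>/2 from
  \<open>0\<close>, because \<open>b - a \<le> 1 / 2\<close>. That part is stretched by
  \<open>r\<close> and the rest is not shrunk, so the whole is stretched by
  \<open>R = 1 + (r - 1) * \<eta>\<close>; the contraction factor is \<open>1 / R\<close>.\<close>

lemma contraction_away_from_0:
  assumes \<eta>: "0 < \<eta>" "\<eta> \<le> 1 / 2"
  obtains \<theta> where "0 < \<theta>" "\<theta> < 1"
    "\<And>a b. \<bar>a - b\<bar> \<le> 1 / 2 \<Longrightarrow> (to_circle a \<in> ball 0 \<eta> \<and> to_circle b \<in> ball 0 \<eta>) \<or> \<bar>a - b\<bar> \<le> \<theta> * \<bar>F a - F b\<bar>"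
proof -
  obtain r where r: "r > 1"
    "\<And>a b. a \<le> b \<Longrightarrow> (\<And>t. a < t \<Longrightarrow> t < b \<Longrightarrow> \<eta> / 2 \<le> dist (to_circle t) 0) \<Longrightarrow> r * (b - a) \<le> G b - G a"
    using G_strong_expansion[of "\<eta> / 2"] \<eta> by (metis half_gt_zero)
  define R where "R = 1 + (r - 1) * \<eta>"
  have R: "R > 1" unfolding R_def using r \<eta> by simp
  have far: "\<eta> / 2 \<le> dist (to_circle t) 0" if "\<bar>t - s\<bar> \<le> \<eta> / 2" "to_circle s \<notin> ball 0 \<eta>" for s t
    using that dist_triangle[of "to_circle s" 0 "to_circle t"] dist_to_circle_le[of s t]
    by (simp add: dist_commute abs_minus_commute)
  have main: "R * (b - a) \<le> G b - G a"
    if ab: "a \<le> b" "b - a \<le> 1 / 2" and out: "to_circle a \<notin> ball 0 \<eta> \<or> to_circle b \<notin> ball 0 \<eta>" for a b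
  proof -
    define l where "l = \<eta> * (b - a)"
    have l: "0 \<le> l" "l \<le> b - a" "l \<le> \<eta> / 2"
      unfolding l_def using ab \<eta> mult_left_mono[of "b - a" "1/2" \<eta>] mult_right_mono[of \<eta> 1 "b - a"] by auto
    have Rl: "R * (b - a) = (b - a) + (r - 1) * l" by (simp add: R_def l_def algebra_simps)
    from out show ?thesis
    proof
      assume a: "to_circle a \<notin> ball 0 \<eta>"
      have "r * (a + l - a) \<le> G (a + l) - G a"
        using l by (intro r(2) far[OF _ a]) auto
      moreover have "b - (a + l) \<le> G b - G (a + l)" using l by (intro G_weak_expansion) auto
      ultimately show ?thesis unfolding Rl by (simp add: algebra_simps)
    next
      assume b: "to_circle b \<notin> ball 0 \<eta>"
      have "r * (b - (b - l)) \<le> G b - G (b - l)"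
        using l by (intro r(2) far[OF _ b]) auto
      moreover have "(b - l) - a \<le> G (b - l) - G a" using l by (intro G_weak_expansion) auto
      ultimately show ?thesis unfolding Rl by (simp add: algebra_simps)
    qed
  qed
  show ?thesis
  proof (rule that[of "1 / R"])
    show "0 < 1 / R" "1 / R < 1" using R by auto
    fix a b :: real assume ab: "\<bar>a - b\<bar> \<le> 1 / 2"
    show "(to_circle a \<in> ball 0 \<eta> \<and> to_circle b \<in> ball 0 \<eta>) \<or> \<bar>a - b\<bar> \<le> 1 / R * \<bar>F a - F b\<bar>"
    proof (rule disjCI)
      assume "\<not> \<bar>a - b\<bar> \<le> 1 / R * \<bar>F a - F b\<bar>"
      then have lt: "\<bar>G a - G b\<bar> < R * \<bar>a - b\<bar>" using R by (simp add: abs_G_diff field_simps)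
      show "to_circle a \<in> ball 0 \<eta> \<and> to_circle b \<in> ball 0 \<eta>"
      proof (cases "a \<le> b")
        case True
        then show ?thesis using main[of a b] ab lt by (auto simp: abs_if split: if_splits)
      next
        case False
        then show ?thesis using main[of b a] ab lt by (auto simp: abs_if split: if_splits)
      qed
    qed
  qed
qed

lemma F_weak_expansion: "\<bar>a - b\<bar> \<le> \<bar>F a - F b\<bar>"
  using G_weak_expansion[of a b] G_weak_expansion[of b a] abs_G_diff[of a b] by (cases "a \<le> b") auto

lemma surj_F: "surj F"
proof -
  have "\<exists>x. G x = y" for y
  proof -
    let ?d = "\<bar>y - G 0\<bar>"
    have "G (- ?d) \<le> y" "y \<le> G ?d" using G_weak_expansion[of "- ?d" 0] G_weak_expansion[of 0 ?d] by auto
    then show ?thesis using IVT'[of G "- ?d" y ?d] cont_G continuous_on_subset by fastforce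
  qed
  then have "\<exists>x. F x = y" for y
    unfolding G_def orientation_def by (metis minus_equation_iff mult_1 mult_minus1)
  then show ?thesis by (metis surjI surj_def)
qed

abbreviation \<Phi> where "\<Phi> \<equiv> inv F"

lemma F_\<Phi>: "F (\<Phi> u) = u" using surj_F by (rule surj_f_inv_f)

lemma \<Phi>_F: "\<Phi> (F t) = t" using inj_circle_lift[OF cov lift] by (rule inv_f_f)

text \<open>\<open>\<Phi> u\<close> and \<open>\<Phi> v\<close> give the same circle point exactly
  when \<open>u - v\<close> is a multiple of the degree \<open>m\<close>. So the shifts by
  \<open>0, ..., \<bar>m\<bar> - 1\<close> list the fibre once, and counting identifies
  \<open>\<bar>m\<bar>\<close> with \<open>k\<close>. Using the same shift over two nearby base
  points follows one inverse branch.\<close>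

lemma fibre_enumeration:
  assumes card: "\<And>x. card (T -` {x}) = k" and k: "k > 0"
  shows "bij_betw (\<lambda>j. to_circle (\<Phi> (s + real j))) {..<k} (T -` {to_circle s})"
proof -
  obtain m where m: "\<And>t i. F (t + of_int i) = F t + of_int (i * m)"
    using circle_lift_degree[OF lift] by blast
  have m0: "m \<noteq> 0"
    using m[of 0 1] injD[OF inj_circle_lift[OF cov lift], of 0 1] by auto
  let ?f = "\<lambda>j. to_circle (\<Phi> (s + real j))"
  have eq: "to_circle (\<Phi> u) = to_circle (\<Phi> v) \<longleftrightarrow> (\<exists>i. u = v + of_int (i * m))" for u v
  proof
    assume "to_circle (\<Phi> u) = to_circle (\<Phi> v)"
    then obtain i where "\<Phi> u - \<Phi> v = of_int i" unfolding to_circle_eq_iff by (elim Ints_cases)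
    then have "\<Phi> u = \<Phi> v + of_int i" by simp
    then have "u = v + of_int (i * m)" using m[of "\<Phi> v" i] F_\<Phi> by metis
    then show "\<exists>i. u = v + of_int (i * m)" ..
  next
    assume "\<exists>i. u = v + of_int (i * m)"
    then obtain i where "u = F (\<Phi> v + of_int i)" using m[of "\<Phi> v"] F_\<Phi> by metis
    then have "\<Phi> u = \<Phi> v + of_int i" by (simp add: \<Phi>_F)
    then show "to_circle (\<Phi> u) = to_circle (\<Phi> v)" by (simp add: to_circle_eq_iff)
  qed
  have "bij_betw ?f {..<nat \<bar>m\<bar>} (T -` {to_circle s})"
    unfolding bij_betw_def
  proof
    show "inj_on ?f {..<nat \<bar>m\<bar>}"
    proof (rule inj_onI)
      fix i j assume ij: "i \<in> {..<nat \<bar>m\<bar>}" "j \<in> {..<nat \<bar>m\<bar>}" "?f i = ?f j"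
      then obtain n where "s + real i = s + real j + of_int (n * m)" unfolding eq by blast
      then have "real_of_int (int i - int j) = real_of_int (n * m)" by simp
      then have "int i - int j = n * m" by (simp only: of_int_eq_iff)
      then have "m dvd int i - int j" by simp
      moreover have "\<bar>int i - int j\<bar> < \<bar>m\<bar>" using ij by auto
      ultimately show "i = j" using dvd_imp_le_int[of "int i - int j" m] by fastforce
    qed
    show "?f ` {..<nat \<bar>m\<bar>} = T -` {to_circle s}"
    proof (intro equalityI subsetI)
      fix z assume "z \<in> ?f ` {..<nat \<bar>m\<bar>}"
      then show "z \<in> T -` {to_circle s}" by (auto simp: T_eq F_\<Phi> to_circle_eq_iff)
    next
      fix z assume z: "z \<in> T -` {to_circle s}"
      obtain t where t: "to_circle t = z" using to_circle_surj by blast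
      then have "to_circle (F t) = to_circle s" using z T_eq[of t] by simp
      then obtain n where n: "F t - s = of_int n" unfolding to_circle_eq_iff by (elim Ints_cases)
      define j where "j = nat (n mod \<bar>m\<bar>)"
      have j: "j < nat \<bar>m\<bar>" "int j = n mod \<bar>m\<bar>" using m0 by (auto simp: j_def)
      have "m dvd n - n mod \<bar>m\<bar>" by (metis abs_dvd_iff dvd_minus_mod)
      then obtain i where "n = int j + i * m" unfolding j(2) by (metis add.commute diff_add_cancel dvdE mult.commute)
      then have "real_of_int n = real j + real_of_int (i * m)" by (metis of_int_add of_int_of_nat_eq)
      then have "F t = s + real j + of_int (i * m)" using n by linarith
      then have "to_circle (\<Phi> (F t)) = ?f j" unfolding eq by blast
      then show "z \<in> ?f ` {..<nat \<bar>m\<bar>}" using t j(1) by (auto simp: \<Phi>_F)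
    qed
  qed
  moreover from bij_betw_same_card[OF this] have "nat \<bar>m\<bar> = k" using card by simp
  ultimately show ?thesis by simp
qed

end

text \<open>The points are represented by reals \<open>s\<close>, \<open>s'\<close> at their circle
  distance and pulled back by \<Phi> after the same integer shift. The pulled back reals are at most
  1/2 apart, so their distance on the line is their circle distance.\<close>

lemma fibre_pairing:
  fixes T :: "circle \<Rightarrow> circle"
  assumes k: "k \<ge> 2" and cov: "covering_space UNIV T UNIV" and card: "\<And>x. card (T -` {x}) = k"
    and exp: "uniformly_expanding_away_from T 0" and e: "e > 0"
  obtains \<eta> \<theta> where "0 < \<eta>" "\<eta> \<le> e" "0 < \<theta>" "\<theta> < 1"
    "\<And>x y. \<exists>p q. bij_betw p {..<k} (T -` {x}) \<and> bij_betw q {..<k} (T -` {y}) \<and>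
      (\<forall>j<k. dist (p j) (q j) \<le> dist x y \<and>
        (p j \<in> ball 0 \<eta> \<and> q j \<in> ball 0 \<eta> \<or> dist (p j) (q j) \<le> \<theta> * dist x y)) \<and>
      (\<exists>j<k. dist (p j) (q j) \<le> \<theta> * dist x y)"
proof -
  obtain F where F: "circle_lift T F"
    using circle_lift_exists covering_space_imp_continuous[OF cov] by blast
  interpret expanding_lift T F by unfold_locales (fact cov F exp)+
  obtain d where d: "d > 0" "inj_on T (ball 0 d)" using covering_space_locally_inj[OF cov] by metis
  \<comment> \<open>Below \<open>d\<close> so that \<open>T\<close> is injective on the ball, below
    \<open>e\<close> as the caller needs for the flat region, and below 1/2 for
    \<open>contraction_away_from_0\<close>.\<close>
  define \<eta> where "\<eta> = min (min d e) (1/2)"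
  have \<eta>: "0 < \<eta>" "\<eta> \<le> e" "\<eta> \<le> 1/2" "\<eta> \<le> d" using d e by (auto simp: \<eta>_def)
  obtain \<theta> where \<theta>: "0 < \<theta>" "\<theta> < 1"
    "\<And>a b. \<bar>a - b\<bar> \<le> 1 / 2 \<Longrightarrow> (to_circle a \<in> ball 0 \<eta> \<and> to_circle b \<in> ball 0 \<eta>) \<or> \<bar>a - b\<bar> \<le> \<theta> * \<bar>F a - F b\<bar>"
    using contraction_away_from_0[OF \<eta>(1,3)] by metis
  show ?thesis
  proof (rule that[OF \<eta>(1,2) \<theta>(1,2)])
    fix x y :: circle
    obtain s where s: "to_circle s = x" using to_circle_surj by blast
    obtain s' where s': "to_circle s' = y" "\<bar>s - s'\<bar> = dist x y"
      using ex_near_representative[of y s] s by metis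
    define p where "p j = to_circle (\<Phi> (s + real j))" for j
    define q where "q j = to_circle (\<Phi> (s' + real j))" for j
    have bij: "bij_betw p {..<k} (T -` {x})" "bij_betw q {..<k} (T -` {y})"
      using fibre_enumeration[OF card, of s] fibre_enumeration[OF card, of s'] k s s'(1)
      unfolding p_def q_def by auto
    have weak: "\<bar>\<Phi> (s + real j) - \<Phi> (s' + real j)\<bar> \<le> dist x y" for j
      using F_weak_expansion[of "\<Phi> (s + real j)" "\<Phi> (s' + real j)"] s'(2) by (simp add: F_\<Phi>)
    then have small: "\<bar>\<Phi> (s + real j) - \<Phi> (s' + real j)\<bar> \<le> 1 / 2" for j
      using dist_circle_le_half[of x y] by (meson order_trans)
    have pq: "dist (p j) (q j) = \<bar>\<Phi> (s + real j) - \<Phi> (s' + real j)\<bar>" for j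
      unfolding p_def q_def by (rule dist_to_circle_eq[OF small])
    have alt: "p j \<in> ball 0 \<eta> \<and> q j \<in> ball 0 \<eta> \<or> dist (p j) (q j) \<le> \<theta> * dist x y" for j
      using \<theta>(3)[OF small, of j] unfolding pq[of j] s'(2)[symmetric] by (simp add: F_\<Phi> p_def q_def)
    \<comment> \<open>The indices 0 and 1 suffice: two distinct preimages of \<open>x\<close> cannot
      both lie where \<open>T\<close> is injective.\<close>
    have "\<exists>j<k. dist (p j) (q j) \<le> \<theta> * dist x y"
    proof (rule ccontr)
      assume "\<not> ?thesis"
      then have "p 0 \<in> ball 0 \<eta>" "p 1 \<in> ball 0 \<eta>" using alt[of 0] alt[of 1] k by auto
      then have in_d: "p 0 \<in> ball 0 d" "p 1 \<in> ball 0 d" using \<eta>(4) by auto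
      have "T (p 0) = x" "T (p 1) = x" using bij_betwE[OF bij(1)] k by auto
      then have "p 0 = p 1" using inj_onD[OF d(2) _ in_d] by simp
      then show False using bij_betw_imp_inj_on[OF bij(1)] k by (auto dest!: inj_onD)
    qed
    then show "\<exists>p q. bij_betw p {..<k} (T -` {x}) \<and> bij_betw q {..<k} (T -` {y}) \<and>
      (\<forall>j<k. dist (p j) (q j) \<le> dist x y \<and>
        (p j \<in> ball 0 \<eta> \<and> q j \<in> ball 0 \<eta> \<or> dist (p j) (q j) \<le> \<theta> * dist x y)) \<and>
      (\<exists>j<k. dist (p j) (q j) \<le> \<theta> * dist x y)"
      using bij alt weak pq by (intro exI[of _ p] exI[of _ q]) auto
  qed
qed

section \<open>Cones of log-Hoelder functions\<close>

text \<open>Apart from the zero function every member is positive everywhere and has an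
  \<alpha>-Hoelder logarithm with constant \<open>K\<close>. The product form admits zero and passes
  to pointwise limits.\<close>

definition log_holder_cone :: "real \<Rightarrow> real \<Rightarrow> (circle \<Rightarrow> real) set"
  where "log_holder_cone \<alpha> K = {f. (\<forall>x. 0 \<le> f x) \<and> (\<forall>x y. f x \<le> exp (K * dist x y powr \<alpha>) * f y)}"

lemma log_holder_coneD:
  assumes "f \<in> log_holder_cone \<alpha> K"
  shows "0 \<le> f x" "f x \<le> exp (K * dist x y powr \<alpha>) * f y"
  using assms by (auto simp: log_holder_cone_def)

lemma circle_dist_powr_le_1:
  fixes x y :: circle
  assumes "0 < \<alpha>"
  shows "dist x y powr \<alpha> \<le> 1"
  using dist_circle_le_half[of x y] powr_mono2[of \<alpha> "dist x y" 1] assms by simp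

lemma exp_mult_le_chord:
  fixes K u :: real
  assumes "0 \<le> u" "u \<le> 1"
  shows "exp (K * u) - 1 \<le> (exp K - 1) * u"
proof -
  have "exp ((1 - u) *\<^sub>R 0 + u *\<^sub>R K) \<le> (1 - u) * exp 0 + u * exp K"
    using assms exp_convex by (intro convex_onD[of UNIV]) auto
  then show ?thesis by (simp add: algebra_simps)
qed

text \<open>With \<open>u = dist x y powr \<alpha>\<close>, paired terms have ratio at most
  \<open>exp (K * u)\<close>, and at most \<open>exp (K0 * u)\<close> with \<open>K0 < K\<close> on
  a strict branch. The strict term has at least the share \<pi> of the sum, so the ratio of the sums
  is at most \<open>exp (K * u) * (1 - \<pi> * c * u)\<close>, hence at most
  \<open>exp ((K - \<pi> * c) * u)\<close>.\<close>

lemma transfer_operator_improves_cone: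
  fixes T :: "circle \<Rightarrow> circle"
  assumes k: "k \<ge> 2" and card: "\<And>x. card (T -` {x}) = k"
    and C0: "0 \<le> C\<^sub>0" "\<And>x y. \<bar>A x - A y\<bar> \<le> C\<^sub>0 * dist x y powr \<alpha>" and \<alpha>: "0 < \<alpha>"
    and flat: "A constant_on B"
    and \<theta>: "0 < \<theta>" "\<theta> < 1"
    and pairing: "\<And>x y. \<exists>p q. bij_betw p {..<k} (T -` {x}) \<and> bij_betw q {..<k} (T -` {y}) \<and>
      (\<forall>j<k. dist (p j) (q j) \<le> dist x y \<and>
        (p j \<in> B \<and> q j \<in> B \<or> dist (p j) (q j) \<le> \<theta> * dist x y)) \<and>
      (\<exists>j<k. dist (p j) (q j) \<le> \<theta> * dist x y)"
  obtains K K' where "0 < K'" "K' < K"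
    "\<And>f. f \<in> log_holder_cone \<alpha> K \<Longrightarrow> transfer_operator T A f \<in> log_holder_cone \<alpha> K'"
proof -
  define \<tau> where "\<tau> = \<theta> powr \<alpha>"
  have \<tau>: "0 < \<tau>" "\<tau> < 1" unfolding \<tau>_def using \<theta> \<alpha> powr_less_mono2[of \<alpha> \<theta> 1] by auto
  \<comment> \<open>Chosen so that the contraction by \<tau> absorbs the distortion
    \<open>C\<^sub>0\<close> of the potential: \<open>(C\<^sub>0 + K) * \<tau> < K\<close>, with
    margin exactly \<open>1 - \<tau>\<close>.\<close>
  define K where "K = C\<^sub>0 * \<tau> / (1 - \<tau>) + 1"
  define K0 where "K0 = (C\<^sub>0 + K) * \<tau>"
  have K1: "K \<ge> 1" unfolding K_def using C0 \<tau> by simp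
  have "(K - 1) * (1 - \<tau>) = C\<^sub>0 * \<tau>" unfolding K_def using \<tau> by simp
  then have "K - K0 = 1 - \<tau>" unfolding K0_def by (simp add: algebra_simps)
  then have K0: "K0 < K" using \<tau> by simp
  \<comment> \<open>\<pi> bounds from below the share of any single term in the fibre sum: distances
    on the circle are below 1, so two terms differ by a factor of at most
    \<open>exp (C\<^sub>0 + K)\<close>.\<close>
  define \<pi> where "\<pi> = exp (- (C\<^sub>0 + K)) / real k"
  define c where "c = 1 - exp (- (K - K0))"
  have c: "0 < c" "c < 1" unfolding c_def using K0 by auto
  have "exp (- (C\<^sub>0 + K)) < 1" using C0 K1 by simp
  moreover have "1 \<le> real k" using k by simp
  ultimately have "exp (- (C\<^sub>0 + K)) < real k" by linarith
  then have \<pi>: "0 < \<pi>" "\<pi> < 1" unfolding \<pi>_def using k by (auto simp: divide_less_eq)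
  have "\<pi> * c < 1 * 1" using \<pi> c by (intro mult_strict_mono) auto
  then have \<pi>c: "0 < \<pi> * c" "\<pi> * c < 1" using \<pi> c by auto
  show ?thesis
  proof (rule that[of "K - \<pi> * c" K])
    show "0 < K - \<pi> * c" "K - \<pi> * c < K" using K1 \<pi>c by auto
    fix f assume f: "f \<in> log_holder_cone \<alpha> K"
    note f0 = log_holder_coneD(1)[OF f] and fK = log_holder_coneD(2)[OF f]
    let ?L = "transfer_operator T A f"
    have "?L x \<le> exp ((K - \<pi> * c) * dist x y powr \<alpha>) * ?L y" for x y
    proof -
      obtain p q where p: "bij_betw p {..<k} (T -` {x})" and q: "bij_betw q {..<k} (T -` {y})"
        and d: "\<And>j. j < k \<Longrightarrow> dist (p j) (q j) \<le> dist x y"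
        and alt: "\<And>j. j < k \<Longrightarrow> p j \<in> B \<and> q j \<in> B \<or> dist (p j) (q j) \<le> \<theta> * dist x y"
        and ex: "\<exists>j<k. dist (p j) (q j) \<le> \<theta> * dist x y"
        using pairing[of x y] by blast
      obtain j0 where j0: "j0 < k" "dist (p j0) (q j0) \<le> \<theta> * dist x y" using ex by blast
      define u where "u = dist x y powr \<alpha>"
      have u: "0 \<le> u" "u \<le> 1" unfolding u_def using circle_dist_powr_le_1[OF \<alpha>] by auto
      define a where "a j = exp (A (p j)) * f (p j)" for j
      define b where "b j = exp (A (q j)) * f (q j)" for j
      have b0: "0 \<le> b j" for j unfolding b_def using f0 by simp
      have La: "?L x = (\<Sum>j<k. a j)"
        unfolding transfer_operator_def a_def
        using sum.reindex_bij_betw[OF p, of "\<lambda>y. exp (A y) * f y"] by (simp add: vimage_def)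
      have Lb: "?L y = (\<Sum>j<k. b j)"
        unfolding transfer_operator_def b_def
        using sum.reindex_bij_betw[OF q, of "\<lambda>y. exp (A y) * f y"] by (simp add: vimage_def)
      have strict: "a j \<le> exp (K0 * u) * b j" if "dist (p j) (q j) \<le> \<theta> * dist x y" for j
      proof -
        let ?v = "dist (p j) (q j) powr \<alpha>"
        have v: "?v \<le> \<tau> * u"
          using powr_mono2[OF less_imp_le[OF \<alpha>] zero_le_dist that] \<theta>
          by (simp add: powr_mult \<tau>_def u_def)
        have "A (p j) \<le> A (q j) + C\<^sub>0 * ?v" using C0(2)[of "p j" "q j"] by linarith
        then have "a j \<le> exp (A (q j) + C\<^sub>0 * ?v) * (exp (K * ?v) * f (q j))"
          unfolding a_def using fK f0 by (intro mult_mono) auto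
        also have "\<dots> = exp ((C\<^sub>0 + K) * ?v) * b j"
          by (simp add: b_def exp_add[symmetric] algebra_simps)
        also have "(C\<^sub>0 + K) * ?v \<le> K0 * u"
          using mult_left_mono[OF v, of "C\<^sub>0 + K"] C0 K1 by (simp add: K0_def algebra_simps)
        then have "exp ((C\<^sub>0 + K) * ?v) * b j \<le> exp (K0 * u) * b j"
          using b0 by (intro mult_right_mono) auto
        finally show ?thesis .
      qed
      have weak: "a j \<le> exp (K * u) * b j" if j: "j < k" for j
      proof (cases "dist (p j) (q j) \<le> \<theta> * dist x y")
        case True
        have "exp (K0 * u) \<le> exp (K * u)" using K0 u by (simp add: mult_right_mono)
        then show ?thesis by (rule order_trans[OF strict[OF True] mult_right_mono[OF _ b0]])
      next
        case False
        with alt[OF j] have A: "A (p j) = A (q j)" using flat unfolding constant_on_def by metis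
        have "dist (p j) (q j) powr \<alpha> \<le> u"
          unfolding u_def using d[OF j] \<alpha> by (intro powr_mono2) auto
        then have "exp (K * dist (p j) (q j) powr \<alpha>) \<le> exp (K * u)" using K1 by (simp add: mult_left_mono)
        then have "f (p j) \<le> exp (K * u) * f (q j)"
          by (rule order_trans[OF fK mult_right_mono[OF _ f0]])
        then have "exp (A (q j)) * f (p j) \<le> exp (A (q j)) * (exp (K * u) * f (q j))"
          by (intro mult_left_mono) auto
        then show ?thesis unfolding a_def b_def A by (simp add: algebra_simps)
      qed
      have compare: "b j \<le> exp (C\<^sub>0 + K) * b j0" for j
      proof -
        let ?v = "dist (q j) (q j0) powr \<alpha>"
        have v: "?v \<le> 1" by (rule circle_dist_powr_le_1[OF \<alpha>])
        have "A (q j) \<le> A (q j0) + C\<^sub>0 * ?v" using C0(2)[of "q j" "q j0"] by linarith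
        also have "\<dots> \<le> A (q j0) + C\<^sub>0" using v C0(1) by (simp add: mult_left_le)
        finally have 1: "exp (A (q j)) \<le> exp (A (q j0) + C\<^sub>0)" by simp
        have "exp (K * ?v) \<le> exp K" using v K1 by (simp add: mult_left_le)
        then have "f (q j) \<le> exp K * f (q j0)"
          by (rule order_trans[OF fK mult_right_mono[OF _ f0]])
        with 1 have "b j \<le> exp (A (q j0) + C\<^sub>0) * (exp K * f (q j0))"
          unfolding b_def using f0 by (intro mult_mono) auto
        then show ?thesis by (simp add: b_def exp_add algebra_simps)
      qed
      have "(\<Sum>j<k. b j) \<le> (\<Sum>j<k. exp (C\<^sub>0 + K) * b j0)" by (intro sum_mono compare)
      also have "\<dots> = real k * (exp (C\<^sub>0 + K) * b j0)" by simp
      finally have "\<pi> * (\<Sum>j<k. b j) \<le> \<pi> * (real k * (exp (C\<^sub>0 + K) * b j0))"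
        using \<pi> by (intro mult_left_mono) auto
      also have "\<dots> = (exp (- (C\<^sub>0 + K)) * exp (C\<^sub>0 + K)) * b j0"
        unfolding \<pi>_def using k by simp
      also have "exp (- (C\<^sub>0 + K)) * exp (C\<^sub>0 + K) = 1" by (simp add: exp_add[symmetric])
      finally have weight: "\<pi> * (\<Sum>j<k. b j) \<le> b j0" by simp
      define S where "S = (\<Sum>j<k. b j)"
      have S0: "0 \<le> S" unfolding S_def by (intro sum_nonneg b0)
      have S: "S = b j0 + (\<Sum>j\<in>{..<k} - {j0}. b j)" unfolding S_def using j0 by (subst sum.remove) auto
      have "(\<Sum>j<k. a j) = a j0 + (\<Sum>j\<in>{..<k} - {j0}. a j)" using j0 by (subst sum.remove) auto
      also have "\<dots> \<le> exp (K0 * u) * b j0 + (\<Sum>j\<in>{..<k} - {j0}. exp (K * u) * b j)"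
        by (intro add_mono sum_mono strict j0 weak) auto
      also have "(\<Sum>j\<in>{..<k} - {j0}. exp (K * u) * b j) = exp (K * u) * (S - b j0)"
        using S by (simp add: sum_distrib_left[symmetric])
      also have "exp (K0 * u) = exp (K * u) * exp (- ((K - K0) * u))"
        by (simp add: exp_add[symmetric] algebra_simps)
      also have "exp (K * u) * exp (- ((K - K0) * u)) * b j0 + exp (K * u) * (S - b j0)
          = exp (K * u) * (S - (1 - exp (- ((K - K0) * u))) * b j0)"
        by (simp add: algebra_simps)
      also have "\<dots> \<le> exp (K * u) * (S - (u * c) * (\<pi> * S))"
      proof -
        have "(u * c) * (\<pi> * S) \<le> (1 - exp (- ((K - K0) * u))) * b j0"
        proof (rule mult_mono)
          \<comment> \<open>Convexity with a negative exponent: the gain on the strict branch is at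
            least linear in \<open>u\<close>, uniformly down to \<open>u = 0\<close>.\<close>
          show "u * c \<le> 1 - exp (- ((K - K0) * u))"
            unfolding c_def using exp_mult_le_chord[OF u, of "- (K - K0)"] by (simp add: algebra_simps)
        qed (use u K0 \<pi> S0 weight in \<open>auto simp: S_def\<close>)
        then show ?thesis by simp
      qed
      also have "\<dots> = exp (K * u) * ((1 + - (\<pi> * c * u)) * S)" by (simp add: algebra_simps)
      also have "\<dots> \<le> exp (K * u) * (exp (- (\<pi> * c * u)) * S)"
        using S0 by (intro mult_left_mono mult_right_mono exp_ge_add_one_self) auto
      also have "\<dots> = (exp (K * u) * exp (- (\<pi> * c * u))) * S" by (rule mult.assoc[symmetric])
      also have "exp (K * u) * exp (- (\<pi> * c * u)) = exp ((K - \<pi> * c) * u)"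
        by (simp add: exp_add[symmetric] left_diff_distrib)
      finally show ?thesis unfolding La Lb S_def u_def .
    qed
    moreover have "0 \<le> ?L x" for x
      unfolding transfer_operator_def using f0 by (intro sum_nonneg) auto
    ultimately show "?L \<in> log_holder_cone \<alpha> (K - \<pi> * c)" by (auto simp: log_holder_cone_def)
  qed
qed

section \<open>Closure properties of the cone and its relation to Hoelder functions\<close>

lemma log_holder_cone_scale:
  assumes "f \<in> log_holder_cone \<alpha> K" "0 \<le> a"
  shows "(\<lambda>x. a * f x) \<in> log_holder_cone \<alpha> K"
  using assms mult_left_mono[of _ _ a] unfolding log_holder_cone_def
  by (auto simp: mult.left_commute[of _ a])

lemma log_holder_cone_mono:
  assumes "K \<le> K'"
  shows "log_holder_cone \<alpha> K \<subseteq> log_holder_cone \<alpha> K'"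
proof
  fix f assume f: "f \<in> log_holder_cone \<alpha> K"
  have "f x \<le> exp (K' * dist x y powr \<alpha>) * f y" for x y
  proof -
    have "exp (K * dist x y powr \<alpha>) \<le> exp (K' * dist x y powr \<alpha>)"
      using assms by (simp add: mult_right_mono)
    then show ?thesis
      by (rule order_trans[OF log_holder_coneD(2)[OF f] mult_right_mono[OF _ log_holder_coneD(1)[OF f]]])
  qed
  with f show "f \<in> log_holder_cone \<alpha> K'" by (auto simp: log_holder_cone_def)
qed

lemma one_in_log_holder_cone: "0 \<le> K \<Longrightarrow> (\<lambda>_. 1) \<in> log_holder_cone \<alpha> K"
  by (auto simp: log_holder_cone_def)

lemma log_holder_cone_limit:
  assumes "\<And>n. f n \<in> log_holder_cone \<alpha> K" "\<And>x. (\<lambda>n. f n x) \<longlonglongrightarrow> g x"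
  shows "g \<in> log_holder_cone \<alpha> K"
proof -
  have "0 \<le> g x" for x
    by (rule LIMSEQ_le_const[OF assms(2)]) (use log_holder_coneD(1)[OF assms(1)] in auto)
  moreover have "g x \<le> exp (K * dist x y powr \<alpha>) * g y" for x y
    by (rule LIMSEQ_le[OF assms(2) tendsto_mult_left[OF assms(2)]])
      (use log_holder_coneD(2)[OF assms(1)] in auto)
  ultimately show ?thesis by (auto simp: log_holder_cone_def)
qed

lemma log_holder_cone_le:
  assumes "f \<in> log_holder_cone \<alpha> K" "0 < \<alpha>" "0 \<le> K"
  shows "f x \<le> exp K * f y"
proof -
  have "K * dist x y powr \<alpha> \<le> K * 1"
    using assms circle_dist_powr_le_1 by (intro mult_left_mono) auto
  then have "exp (K * dist x y powr \<alpha>) * f y \<le> exp K * f y"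
    using log_holder_coneD(1)[OF assms(1)] by (intro mult_right_mono) auto
  with log_holder_coneD(2)[OF assms(1), of x y] show ?thesis by linarith
qed

lemma log_holder_cone_holder_bound:
  assumes f: "f \<in> log_holder_cone \<alpha> K" and \<alpha>: "0 < \<alpha>" and K: "0 \<le> K" and S: "\<And>x. f x \<le> S"
  shows "\<bar>f x - f y\<bar> \<le> (exp K - 1) * S * dist x y powr \<alpha>"
proof -
  have *: "f x - f y \<le> (exp K - 1) * S * dist x y powr \<alpha>" for x y
  proof -
    let ?u = "dist x y powr \<alpha>"
    have "f x - f y \<le> (exp (K * ?u) - 1) * f y"
      using log_holder_coneD(2)[OF f, of x y] by (simp add: algebra_simps)
    also have "\<dots> \<le> ((exp K - 1) * ?u) * f y"
      using log_holder_coneD(1)[OF f] circle_dist_powr_le_1[OF \<alpha>]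
      by (intro mult_right_mono exp_mult_le_chord) auto
    also have "\<dots> \<le> ((exp K - 1) * ?u) * S"
      using S K by (intro mult_left_mono) auto
    finally show ?thesis by (simp add: algebra_simps)
  qed
  from *[of x y] *[of y x] show ?thesis by (simp add: dist_commute abs_le_iff)
qed

text \<open>The added constant lifts the function above \<open>N / K\<close>, so an additive
  variation \<open>N * u\<close> is a relative variation of at most \<open>K * u\<close>, and
  \<open>1 + K * u \<le> exp (K * u)\<close>. Hence every Hoelder function is a difference of
  members of the cone.\<close>

lemma holder_perturbation_in_cone:
  assumes K: "0 < K" and f: "\<And>x. \<bar>f x\<bar> \<le> N" "\<And>x y. \<bar>f x - f y\<bar> \<le> N * dist x y powr \<alpha>"
  shows "(\<lambda>x. f x + (1 + 1 / K) * N) \<in> log_holder_cone \<alpha> K"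
proof -
  have N: "0 \<le> N" using f(1)[of 0] by linarith
  have low: "N / K \<le> f x + (1 + 1 / K) * N" for x
    using f(1)[of x] by (simp add: algebra_simps)
  have "0 \<le> N / K" using N K by simp
  then have 0: "0 \<le> f x + (1 + 1 / K) * N" for x using low[of x] by linarith
  moreover have "f x + (1 + 1 / K) * N \<le> exp (K * dist x y powr \<alpha>) * (f y + (1 + 1 / K) * N)" for x y
  proof -
    let ?u = "dist x y powr \<alpha>"
    have "N * ?u = (K * ?u) * (N / K)" using K by simp
    also have "\<dots> \<le> (K * ?u) * (f y + (1 + 1 / K) * N)"
      using K low by (intro mult_left_mono) auto
    finally have "f x + (1 + 1 / K) * N \<le> (f y + (1 + 1 / K) * N) + K * ?u * (f y + (1 + 1 / K) * N)"
      using f(2)[of x y] by linarith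
    also have "\<dots> = (1 + K * ?u) * (f y + (1 + 1 / K) * N)" by (simp add: distrib_right)
    also have "\<dots> \<le> exp (K * ?u) * (f y + (1 + 1 / K) * N)"
      using 0 by (intro mult_right_mono exp_ge_add_one_self) auto
    finally show ?thesis .
  qed
  ultimately show ?thesis by (auto simp: log_holder_cone_def)
qed

lemma exp_diff_ge: "b - a \<le> exp b - exp a" if "0 \<le> a" "a \<le> b" for a b :: real
proof -
  have "1 * (b - a) \<le> exp a * (exp (b - a) - 1)"
  proof (rule mult_mono)
    show "b - a \<le> exp (b - a) - 1" using exp_ge_add_one_self[of "b - a"] by linarith
  qed (use that in auto)
  then show ?thesis by (simp add: algebra_simps exp_add[symmetric])
qed

lemma exp_diff_le: "exp b - exp a \<le> (b - a) * exp b" for a b :: real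
proof -
  have "exp b * (1 - exp (a - b)) \<le> exp b * (b - a)"
  proof (rule mult_left_mono)
    show "1 - exp (a - b) \<le> b - a" using exp_ge_add_one_self[of "a - b"] by linarith
  qed auto
  then show ?thesis by (simp add: algebra_simps exp_add[symmetric])
qed

text \<open>
  The finite projective diameter of the smaller cone inside the larger one, in the subtractive form
  that is needed for the contraction argument.
\<close>

lemma log_holder_cone_gap:
  assumes K: "0 < K'" "K' < K" and \<alpha>: "0 < \<alpha>"
  obtains c where "0 < c" "c < 1"
    "\<And>f g. f \<in> log_holder_cone \<alpha> K' \<Longrightarrow> g \<in> log_holder_cone \<alpha> K' \<Longrightarrow>
      (\<lambda>x. f 0 * g x - c * g 0 * f x) \<in> log_holder_cone \<alpha> K"
proof -
  \<comment> \<open>Two demands fix \<open>c\<close>: \<open>c * exp (2 * K') \<le> 1\<close> for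
    nonnegativity of the difference, and the balance \<open>cK2\<close> for its log-Hoelder
    bound.\<close>
  define c where "c = (K - K') / (K + K') * exp (- (2 * K' + K))"
  have "(K - K') / (K + K') < 1" "exp (- (2 * K' + K)) < 1" using K by auto
  then have "c < 1 * 1" unfolding c_def using K by (intro mult_strict_mono) auto
  moreover have "0 < c" unfolding c_def using K by simp
  ultimately have c: "0 < c" "c < 1" by auto
  have cK: "c * exp (2 * K') \<le> 1"
  proof -
    have "(K - K') / (K + K') * (exp (- (2 * K' + K)) * exp (2 * K')) \<le> 1 * 1"
      using K by (intro mult_mono) (auto simp: exp_add[symmetric])
    then show ?thesis by (simp add: c_def mult.assoc)
  qed
  have cK2: "c * exp K' * ((K + K') * exp K) = exp (- K') * (K - K')"
  proof -
    have "c * exp K' * ((K + K') * exp K) = (K - K') * (exp (- (2 * K' + K)) * exp K' * exp K)"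
      unfolding c_def using K by (simp add: field_simps)
    also have "exp (- (2 * K' + K)) * exp K' * exp K = exp (- K')" by (simp add: exp_add[symmetric])
    finally show ?thesis by simp
  qed
  show ?thesis
  proof (rule that[of c])
    show "0 < c" "c < 1" using c by auto
    fix f g assume f: "f \<in> log_holder_cone \<alpha> K'" and g: "g \<in> log_holder_cone \<alpha> K'"
    note f0 = log_holder_coneD(1)[OF f] and g0 = log_holder_coneD(1)[OF g]
    have fe: "f x \<le> exp K' * f y" and ge: "g x \<le> exp K' * g y" for x y
      using log_holder_cone_le[OF f \<alpha>] log_holder_cone_le[OF g \<alpha>] K by auto
    have gl: "exp (- K') * g 0 \<le> g y" for y
    proof -
      have "exp (- K') * g 0 \<le> exp (- K') * (exp K' * g y)" using ge by (intro mult_left_mono) auto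
      then show ?thesis by (simp add: mult.assoc[symmetric] exp_add[symmetric])
    qed
    have "0 \<le> f 0 * g x - c * g 0 * f x" for x
    proof -
      have "c * (g 0 * f x) \<le> c * ((exp K' * g x) * (exp K' * f 0))"
        using c f0 g0 fe ge by (intro mult_left_mono mult_mono) auto
      also have "\<dots> = (c * exp (2 * K')) * (f 0 * g x)"
        using exp_double[of K'] by (simp add: power2_eq_square mult_ac)
      also have "\<dots> \<le> 1 * (f 0 * g x)" using cK f0 g0 by (intro mult_right_mono) auto
      finally show ?thesis by (simp add: mult.assoc)
    qed
    moreover have "f 0 * g x - c * g 0 * f x \<le> exp (K * dist x y powr \<alpha>) * (f 0 * g y - c * g 0 * f y)" for x y
    proof -
      define u where "u = dist x y powr \<alpha>"
      have u: "0 \<le> u" "u \<le> 1" unfolding u_def using circle_dist_powr_le_1[OF \<alpha>] by auto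
      \<comment> \<open>Rearranged, the goal is \<open>c * g 0 * (exp (K * u) * f y - f x) \<le> f 0
        * (exp (K * u) * g y - g x)\<close>. The left side is at most, and the right side at least,
        a constant times \<open>f 0 * g 0 * u\<close>; \<open>cK2\<close> equates the two
        constants.\<close>
      have "exp (- (K' * u)) * f y \<le> exp (- (K' * u)) * (exp (K' * u) * f x)"
        using log_holder_coneD(2)[OF f, of y x] by (intro mult_left_mono) (auto simp: u_def dist_commute)
      then have "exp (- (K' * u)) * f y \<le> f x" by (simp add: mult.assoc[symmetric] exp_add[symmetric])
      then have "exp (K * u) * f y - f x \<le> (exp (K * u) - exp (- (K' * u))) * f y" by (simp add: algebra_simps)
      also have "\<dots> \<le> ((K * u + K' * u) * exp (K * u)) * f y"
        using exp_diff_le[of "K * u" "- (K' * u)"] f0 by (intro mult_right_mono) auto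
      also have "\<dots> \<le> ((K + K') * u * exp K) * (exp K' * f 0)"
        using u K f0 fe by (intro mult_mono) (auto simp: distrib_right mult_left_le)
      finally have "c * g 0 * (exp (K * u) * f y - f x) \<le> c * g 0 * (((K + K') * u * exp K) * (exp K' * f 0))"
        using c g0 by (intro mult_left_mono) auto
      also have "\<dots> = (c * exp K' * ((K + K') * exp K)) * (g 0 * f 0 * u)" by simp
      also have "\<dots> = f 0 * ((K - K') * u * (exp (- K') * g 0))" unfolding cK2 by simp
      also have "\<dots> \<le> f 0 * ((exp (K * u) - exp (K' * u)) * g y)"
      proof -
        have Ku: "K' * u \<le> K * u" using K u by (intro mult_right_mono) auto
        then have "(K - K') * u \<le> exp (K * u) - exp (K' * u)"
          using exp_diff_ge[of "K' * u" "K * u"] K u by (simp add: left_diff_distrib)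
        then show ?thesis using gl f0 g0 Ku by (intro mult_left_mono mult_mono) auto
      qed
      also have "\<dots> \<le> f 0 * (exp (K * u) * g y - g x)"
        using log_holder_coneD(2)[OF g, of x y] f0 by (intro mult_left_mono) (auto simp: u_def algebra_simps)
      finally show ?thesis unfolding u_def[symmetric] by (simp add: algebra_simps)
    qed
    ultimately show "(\<lambda>x. f 0 * g x - c * g 0 * f x) \<in> log_holder_cone \<alpha> K"
      by (auto simp: log_holder_cone_def)
  qed
qed

section \<open>Estimates for the Hoelder norm\<close>

lemma holder_space_bounds:
  assumes f: "f \<in> holder_space \<alpha>" and \<alpha>: "0 < \<alpha>"
  shows "\<bar>f x\<bar> \<le> holder_norm \<alpha> f" "\<bar>f x - f y\<bar> \<le> holder_norm \<alpha> f * dist x y powr \<alpha>"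
proof -
  obtain C where C: "\<And>x y. \<bar>f x - f y\<bar> \<le> C * dist x y powr \<alpha>" using f by (auto simp: holder_space_def)
  have C': "\<bar>f x - f y\<bar> \<le> \<bar>C\<bar> * dist x y powr \<alpha>" for x y
    using order_trans[OF C mult_right_mono[OF abs_ge_self]] by simp
  let ?S = "{C. 0 \<le> C \<and> (\<forall>x y. \<bar>f x - f y\<bar> \<le> C * dist x y powr \<alpha>)}"
  have S: "\<bar>C\<bar> \<in> ?S" using C' by auto
  have const: "0 \<le> holder_const \<alpha> f" unfolding holder_const_def
    by (rule cInf_greatest) (use S in blast, auto)
  have "\<bar>f x\<bar> \<le> \<bar>f 0\<bar> + \<bar>C\<bar>" for x
  proof -
    have "\<bar>C\<bar> * dist x 0 powr \<alpha> \<le> \<bar>C\<bar>"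
      using circle_dist_powr_le_1[OF \<alpha>] by (simp add: mult_left_le)
    then show ?thesis using C'[of x 0] by linarith
  qed
  then have bdd: "bdd_above (range (\<lambda>x. \<bar>f x\<bar>))" by (auto simp: bdd_above_def)
  have sup: "\<bar>f x\<bar> \<le> (SUP x. \<bar>f x\<bar>)" for x using bdd by (intro cSUP_upper) auto
  then have sup0: "0 \<le> (SUP x. \<bar>f x\<bar>)" by (meson abs_ge_zero order_trans)
  show "\<bar>f x\<bar> \<le> holder_norm \<alpha> f" using sup[of x] const by (simp add: holder_norm_def)
  have "\<bar>f x - f y\<bar> \<le> holder_const \<alpha> f * dist x y powr \<alpha>"
  proof (cases "x = y")
    case False
    then have d: "0 < dist x y powr \<alpha>" by simp
    have "\<bar>f x - f y\<bar> / dist x y powr \<alpha> \<le> holder_const \<alpha> f"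
      unfolding holder_const_def by (rule cInf_greatest) (use S in blast, use d in \<open>auto simp: divide_le_eq\<close>)
    then show ?thesis using d by (simp add: divide_le_eq)
  qed simp
  also have "\<dots> \<le> holder_norm \<alpha> f * dist x y powr \<alpha>"
    using sup0 by (intro mult_right_mono) (auto simp: holder_norm_def)
  finally show "\<bar>f x - f y\<bar> \<le> holder_norm \<alpha> f * dist x y powr \<alpha>" .
qed

lemma holder_norm_nonneg: "f \<in> holder_space \<alpha> \<Longrightarrow> 0 < \<alpha> \<Longrightarrow> 0 \<le> holder_norm \<alpha> f"
  using holder_space_bounds(1) abs_ge_zero order_trans by blast

lemma holder_norm_le:
  assumes "\<And>x. \<bar>f x\<bar> \<le> S" "\<And>x y. \<bar>f x - f y\<bar> \<le> H * dist x y powr \<alpha>" "0 \<le> H"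
  shows "holder_norm \<alpha> f \<le> S + H"
proof -
  have "(SUP x. \<bar>f x\<bar>) \<le> S" using assms by (intro cSUP_least) auto
  moreover have "holder_const \<alpha> f \<le> H" unfolding holder_const_def
    using assms by (intro cInf_lower) (auto simp: bdd_below_def)
  ultimately show ?thesis by (simp add: holder_norm_def)
qed

lemma continuous_on_holder_space:
  assumes "f \<in> holder_space \<alpha>" "0 < \<alpha>"
  shows "continuous_on S f"
proof -
  have "(f \<longlongrightarrow> f x) (at x)" for x
  proof (rule Lim_null_comparison[of "\<lambda>y. f y - f x", THEN LIM_zero_cancel])
    have "((\<lambda>y. dist y x) \<longlongrightarrow> dist x x) (at x)" by (intro tendsto_intros)
    then have "((\<lambda>y. holder_norm \<alpha> f * dist y x powr \<alpha>) \<longlongrightarrow> holder_norm \<alpha> f * 0 powr \<alpha>) (at x)"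
      using assms(2) by (intro tendsto_mult_left tendsto_powr') (auto simp: eventually_mono)
    then show "((\<lambda>y. holder_norm \<alpha> f * dist y x powr \<alpha>) \<longlongrightarrow> 0) (at x)" using assms(2) by simp
  qed (use holder_space_bounds(2)[OF assms] in auto)
  then show ?thesis by (auto simp: continuous_on_eq_continuous_at isCont_def intro!: continuous_at_imp_continuous_on)
qed

section \<open>Birkhoff contraction\<close>

lemma holder_spaceI: "(\<And>x y. \<bar>f x - f y\<bar> \<le> C * dist x y powr \<alpha>) \<Longrightarrow> f \<in> holder_space \<alpha>"
  unfolding holder_space_def by blast

lemma log_holder_cone_subset_holder_space:
  assumes "0 < \<alpha>" "0 \<le> K"
  shows "log_holder_cone \<alpha> K \<subseteq> holder_space \<alpha>"
proof
  fix f assume f: "f \<in> log_holder_cone \<alpha> K"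
  show "f \<in> holder_space \<alpha>"
    by (rule holder_spaceI log_holder_cone_holder_bound f assms log_holder_cone_le)+
qed

text \<open>From here on the dynamics enters only through finite nonempty fibres and the improvement
  of the cone constant.\<close>

locale cone_contraction =
  fixes T :: "circle \<Rightarrow> circle" and A :: "circle \<Rightarrow> real" and \<alpha> K K' :: real
  assumes finite_fibre: "\<And>x. finite {y. T y = x}" and fibre_nonempty: "\<And>x. {y. T y = x} \<noteq> {}"
    and \<alpha>: "0 < \<alpha>" and K: "0 < K'" "K' < K"
    and improves: "\<And>f. f \<in> log_holder_cone \<alpha> K \<Longrightarrow> transfer_operator T A f \<in> log_holder_cone \<alpha> K'"
begin

abbreviation L where "L \<equiv> transfer_operator T A"
abbreviation cone where "cone \<equiv> log_holder_cone \<alpha> K"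

definition e :: "nat \<Rightarrow> circle \<Rightarrow> real" where "e n = (L ^^ n) (\<lambda>_. 1)"

lemma K0: "0 < K" "0 \<le> K" using K by auto

lemma e_0: "e 0 = (\<lambda>_. 1)" by (simp add: e_def)
lemma e_Suc: "e (Suc n) = L (e n)" by (simp add: e_def)
lemma e_Suc': "e (Suc n) = (L ^^ n) (L (\<lambda>_. 1))" by (simp add: e_def funpow_swap1)

lemma L_linear: "L (\<lambda>x. a * f x + b * g x) = (\<lambda>x. a * L f x + b * L g x)"
  by (rule ext) (simp add: transfer_operator_def sum.distrib[symmetric] sum_distrib_left algebra_simps)

lemma iter_linear: "(L ^^ n) (\<lambda>x. a * f x + b * g x) = (\<lambda>x. a * (L ^^ n) f x + b * (L ^^ n) g x)"
  by (induction n) (simp_all add: L_linear)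

lemma iter_mono:
  assumes "\<And>x. f x \<le> g x"
  shows "(L ^^ n) f x \<le> (L ^^ n) g x"
  using assms by (induction n arbitrary: x) (auto simp: transfer_operator_def intro!: sum_mono)

lemma iter_const: "(L ^^ n) (\<lambda>_. c) = (\<lambda>x. c * e n x)"
  using iter_linear[of n c "\<lambda>_. 1" 0 "\<lambda>_. 1"] by (simp add: e_def)

lemma e_pos: "0 < e n x"
  by (induction n arbitrary: x)
    (auto simp: e_0 e_Suc transfer_operator_def intro!: sum_pos finite_fibre fibre_nonempty)

lemma L_cone: "f \<in> cone \<Longrightarrow> L f \<in> cone"
  using improves log_holder_cone_mono[of K' K \<alpha>] K by auto

lemma e_cone: "e n \<in> cone"
  using K0 by (induction n) (auto simp: e_0 e_Suc L_cone one_in_log_holder_cone)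

lemma cone_subset: "cone \<subseteq> holder_space \<alpha>"
  using log_holder_cone_subset_holder_space \<alpha> K0 by blast

definition gap :: real where
  "gap = (SOME c. 0 < c \<and> c < 1 \<and> (\<forall>f\<in>log_holder_cone \<alpha> K'. \<forall>g\<in>log_holder_cone \<alpha> K'.
      (\<lambda>x. f 0 * g x - c * g 0 * f x) \<in> cone))"

lemma gap:
  shows gap_bounds: "0 < gap" "gap < 1"
    and gap_cone: "\<And>f g. f \<in> log_holder_cone \<alpha> K' \<Longrightarrow> g \<in> log_holder_cone \<alpha> K' \<Longrightarrow>
      (\<lambda>x. f 0 * g x - gap * g 0 * f x) \<in> cone"
proof -
  have "\<exists>c. 0 < c \<and> c < 1 \<and> (\<forall>f\<in>log_holder_cone \<alpha> K'. \<forall>g\<in>log_holder_cone \<alpha> K'.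
      (\<lambda>x. f 0 * g x - c * g 0 * f x) \<in> cone)"
    by (rule log_holder_cone_gap[OF K \<alpha>]) blast
  from someI_ex[OF this, folded gap_def]
  show "0 < gap" "gap < 1" "\<And>f g. f \<in> log_holder_cone \<alpha> K' \<Longrightarrow> g \<in> log_holder_cone \<alpha> K' \<Longrightarrow>
      (\<lambda>x. f 0 * g x - gap * g 0 * f x) \<in> cone" by blast+
qed

text \<open>
  Birkhoff's contraction of the Hilbert projective metric, in elementary form: \<open>L\<^sup>n g\<close> is squeezed
  between multiples of \<open>L\<^sup>n 1\<close> in the order of the cone, and each step narrows the range of the
  multipliers.
\<close>

definition squeezed :: "nat \<Rightarrow> (circle \<Rightarrow> real) \<Rightarrow> real \<Rightarrow> real \<Rightarrow> bool"
  where "squeezed n g m M \<longleftrightarrow>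
    (\<lambda>x. (L ^^ n) g x - m * e n x) \<in> cone \<and> (\<lambda>x. M * e n x - (L ^^ n) g x) \<in> cone"

lemma squeezedD:
  assumes "squeezed n g m M"
  shows "m * e n x \<le> (L ^^ n) g x" "(L ^^ n) g x \<le> M * e n x" "m \<le> M"
proof -
  show 1: "m * e n x \<le> (L ^^ n) g x" "(L ^^ n) g x \<le> M * e n x"
    using assms log_holder_coneD(1) unfolding squeezed_def by fastforce+
  have "m * e n x \<le> M * e n x" using 1 by linarith
  then show "m \<le> M" using e_pos[of n x] by simp
qed

text \<open>After one application of \<open>L\<close> the two cone differences \<open>p\<close> and
  \<open>q\<close> lie in the smaller cone, so each tolerates subtracting \<open>gap\<close> times
  its value at \<open>0\<close> relative to \<open>e (Suc n)\<close>. Since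
  \<open>p + q = (M - m) * e (Suc n)\<close>, the two gains \<open>s\<close> and \<open>t\<close>
  add up to \<open>gap * (M - m)\<close>.\<close>

lemma squeezed_step:
  assumes "squeezed n g m M"
  shows "\<exists>m' M'. squeezed (Suc n) g m' M' \<and> m \<le> m' \<and> M' \<le> M \<and> M' - m' = (1 - gap) * (M - m)"
proof -
  let ?f = "e (Suc n)"
  define p where "p = L (\<lambda>x. (L ^^ n) g x - m * e n x)"
  define q where "q = L (\<lambda>x. M * e n x - (L ^^ n) g x)"
  have p: "p = (\<lambda>x. (L ^^ Suc n) g x - m * ?f x)"
    using L_linear[of 1 "(L ^^ n) g" "- m" "e n"] by (simp add: p_def e_Suc)
  have q: "q = (\<lambda>x. M * ?f x - (L ^^ Suc n) g x)"
    using L_linear[of M "e n" "- 1" "(L ^^ n) g"] by (simp add: q_def e_Suc)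
  have cone': "p \<in> log_holder_cone \<alpha> K'" "q \<in> log_holder_cone \<alpha> K'" "?f \<in> log_holder_cone \<alpha> K'"
    using assms e_cone improves by (auto simp: squeezed_def p_def q_def e_Suc)
  have f0: "0 < ?f 0" by (rule e_pos)
  have *: "(\<lambda>x. r x - gap * (r 0 / ?f 0) * ?f x) \<in> cone" if "r \<in> log_holder_cone \<alpha> K'" for r
    using log_holder_cone_scale[OF gap_cone[OF cone'(3) that], of "1 / ?f 0"] f0
    by (simp add: right_diff_distrib mult.assoc)
  define s t where "s = gap * (p 0 / ?f 0)" and "t = gap * (q 0 / ?f 0)"
  have "0 \<le> s" "0 \<le> t"
    unfolding s_def t_def using f0 gap_bounds log_holder_coneD(1)[OF cone'(1)] log_holder_coneD(1)[OF cone'(2)] by auto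
  moreover have "s + t = gap * (M - m)"
  proof -
    have "p 0 + q 0 = (M - m) * ?f 0" unfolding p q by (simp add: algebra_simps)
    then show ?thesis unfolding s_def t_def using f0 by (simp add: distrib_left[symmetric] add_divide_distrib[symmetric])
  qed
  moreover have "squeezed (Suc n) g (m + s) (M - t)"
    using *[OF cone'(1)] *[OF cone'(2)] unfolding squeezed_def s_def[symmetric] t_def[symmetric]
    unfolding p q by (simp add: algebra_simps)
  ultimately show ?thesis
    by (intro exI[of _ "m + s"] exI[of _ "M - t"]) (auto simp: algebra_simps)
qed

text \<open>The eigenfunctional of the dual operator, normalised to 1 on the constant 1. It precedes
  the measure, which \<open>eigenmeasure\<close> finds as its representation.
  \<open>squeezed_limit\<close> shows that the limit exists on Hoelder functions.\<close>

definition ell :: "(circle \<Rightarrow> real) \<Rightarrow> real" where "ell g = lim (\<lambda>n. (L ^^ n) g 0 / e n 0)"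

text \<open>Iterating \<open>squeezed_step\<close> gives nested intervals whose lengths shrink by
  \<open>1 - gap\<close>; at the point \<open>0\<close> the cone order places the ratio between
  their ends.\<close>

lemma squeezed_limit:
  assumes "squeezed 0 g m\<^sub>0 M\<^sub>0"
  shows "(\<lambda>n. (L ^^ n) g 0 / e n 0) \<longlonglongrightarrow> ell g"
    and "\<exists>m M. squeezed n g m M \<and> m \<le> ell g \<and> ell g \<le> M \<and> M - m = (1 - gap) ^ n * (M\<^sub>0 - m\<^sub>0)"
proof -
  have "\<exists>z. \<forall>n. (squeezed n g (fst (z n)) (snd (z n)) \<and> snd (z n) - fst (z n) = (1 - gap) ^ n * (M\<^sub>0 - m\<^sub>0)) \<and>
      (fst (z n) \<le> fst (z (Suc n)) \<and> snd (z (Suc n)) \<le> snd (z n))"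
  proof (rule dependent_nat_choice)
    show "\<exists>z. squeezed 0 g (fst z) (snd z) \<and> snd z - fst z = (1 - gap) ^ 0 * (M\<^sub>0 - m\<^sub>0)"
      using assms by (intro exI[of _ "(m\<^sub>0, M\<^sub>0)"]) simp
    fix z n assume z: "squeezed n g (fst z) (snd z) \<and> snd z - fst z = (1 - gap) ^ n * (M\<^sub>0 - m\<^sub>0)"
    then obtain m' M' where "squeezed (Suc n) g m' M'" "fst z \<le> m'" "M' \<le> snd z" "M' - m' = (1 - gap) * (snd z - fst z)"
      using squeezed_step by blast
    then show "\<exists>y. (squeezed (Suc n) g (fst y) (snd y) \<and> snd y - fst y = (1 - gap) ^ Suc n * (M\<^sub>0 - m\<^sub>0)) \<and>
        (fst z \<le> fst y \<and> snd y \<le> snd z)"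
      using z by (intro exI[of _ "(m', M')"]) simp
  qed
  then obtain z where z: "\<And>n. squeezed n g (fst (z n)) (snd (z n))"
    "\<And>n. snd (z n) - fst (z n) = (1 - gap) ^ n * (M\<^sub>0 - m\<^sub>0)"
    "\<And>n. fst (z n) \<le> fst (z (Suc n))" "\<And>n. snd (z (Suc n)) \<le> snd (z n)" by blast
  define m M where "m n = fst (z n)" and "M n = snd (z n)" for n
  have inc: "incseq m" and dec: "decseq M" unfolding m_def M_def using z by (auto intro: incseq_SucI decseq_SucI)
  have mM: "m n \<le> M n" for n unfolding m_def M_def using squeezedD(3)[OF z(1)] by blast
  have "m n \<le> M 0" for n using mM[of n] decseqD[OF dec, of 0 n] by auto
  with inc obtain l where l: "m \<longlonglongrightarrow> l" using incseq_convergent by blast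
  have "(\<lambda>n. m n + (1 - gap) ^ n * (M\<^sub>0 - m\<^sub>0)) \<longlonglongrightarrow> l + 0 * (M\<^sub>0 - m\<^sub>0)"
    using gap_bounds by (intro tendsto_intros l LIMSEQ_power_zero) auto
  moreover have "m n + (1 - gap) ^ n * (M\<^sub>0 - m\<^sub>0) = M n" for n using z(2)[of n] by (simp add: m_def M_def)
  ultimately have l': "M \<longlonglongrightarrow> l" by simp
  have lim: "(\<lambda>n. (L ^^ n) g 0 / e n 0) \<longlonglongrightarrow> l"
  proof (rule tendsto_sandwich[OF _ _ l l'])
    show "\<forall>\<^sub>F n in sequentially. m n \<le> (L ^^ n) g 0 / e n 0"
      using squeezedD(1)[OF z(1)] e_pos by (simp add: m_def pos_le_divide_eq)
    show "\<forall>\<^sub>F n in sequentially. (L ^^ n) g 0 / e n 0 \<le> M n"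
      using squeezedD(2)[OF z(1)] e_pos by (simp add: M_def pos_divide_le_eq)
  qed
  then have ell: "ell g = l" unfolding ell_def by (rule limI)
  show "(\<lambda>n. (L ^^ n) g 0 / e n 0) \<longlonglongrightarrow> ell g" unfolding ell by (rule lim)
  have "m n \<le> l" "l \<le> M n" using incseq_le[OF inc l] decseq_ge[OF dec l'] by auto
  then show "\<exists>m M. squeezed n g m M \<and> m \<le> ell g \<and> ell g \<le> M \<and> M - m = (1 - gap) ^ n * (M\<^sub>0 - m\<^sub>0)"
    using z(1,2)[of n] unfolding ell m_def M_def by blast
qed

lemma holder_squeezed:
  assumes f: "f \<in> holder_space \<alpha>"
  defines "a \<equiv> (1 + 1 / K) * holder_norm \<alpha> f"
  shows "squeezed 0 f (- a) a"
proof -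
  note b = holder_space_bounds[OF f \<alpha>]
  have "(\<lambda>x. - f x + a) \<in> cone" unfolding a_def
    using b by (intro holder_perturbation_in_cone K0) (auto simp: abs_minus_commute)
  moreover have "(\<lambda>x. f x + a) \<in> cone" unfolding a_def
    using b by (intro holder_perturbation_in_cone K0) auto
  ultimately show ?thesis by (simp add: squeezed_def e_0)
qed

lemmas ell_LIMSEQ = squeezed_limit(1)[OF holder_squeezed]

text \<open>\<open>L f\<close> is the sum of \<open>L f - m * e 1\<close> and
  \<open>m * e 1\<close>. The first summand and \<open>e 1\<close> lie in the cone, so Hoelder
  regularity follows from cone membership.\<close>

lemma L_holder_space:
  assumes "f \<in> holder_space \<alpha>"
  shows "L f \<in> holder_space \<alpha>"
proof -
  obtain m M where s: "squeezed 1 f m M" using squeezed_limit(2)[OF holder_squeezed[OF assms]] by blast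
  have "(\<lambda>x. 1 * (L f x - m * e 1 x) + m * e 1 x) \<in> holder_space \<alpha>"
    using s cone_subset e_cone by (intro holder_space_linear) (auto simp: squeezed_def)
  then show ?thesis by simp
qed

text \<open>The only possible eigenvalue: \<open>ell (L f) = \<rho> * ell f\<close> at
  \<open>f = 1\<close>. It is also the limit of \<open>e (Suc n) 0 / e n 0\<close>, the form used to
  prove \<open>ell_L\<close>.\<close>

definition \<rho> :: real where "\<rho> = ell (L (\<lambda>_. 1))"

lemma e_holder_space: "e n \<in> holder_space \<alpha>" using e_cone cone_subset by blast

lemma ell_L:
  assumes f: "f \<in> holder_space \<alpha>"
  shows "ell (L f) = \<rho> * ell f"
proof -
  have "(\<lambda>n. (L ^^ n) (L (\<lambda>_. 1)) 0 / e n 0) \<longlonglongrightarrow> \<rho>"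
    unfolding \<rho>_def using e_holder_space[of 1] by (intro ell_LIMSEQ) (simp add: e_def)
  then have "(\<lambda>n. e (Suc n) 0 / e n 0) \<longlonglongrightarrow> \<rho>" unfolding e_Suc' .
  then have "(\<lambda>n. (e (Suc n) 0 / e n 0) * ((L ^^ Suc n) f 0 / e (Suc n) 0)) \<longlonglongrightarrow> \<rho> * ell f"
    by (intro tendsto_mult LIMSEQ_Suc[OF ell_LIMSEQ[OF f]])
  moreover have "(e (Suc n) 0 / e n 0) * ((L ^^ Suc n) f 0 / e (Suc n) 0) = (L ^^ n) (L f) 0 / e n 0" for n
    using e_pos[of "Suc n" 0] by (simp add: funpow_swap1)
  ultimately have "(\<lambda>n. (L ^^ n) (L f) 0 / e n 0) \<longlonglongrightarrow> \<rho> * ell f" by simp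
  then show ?thesis using ell_LIMSEQ[OF L_holder_space[OF f]] LIMSEQ_unique by blast
qed

lemma ell_ge:
  assumes "f \<in> holder_space \<alpha>" "\<And>x. c \<le> f x"
  shows "c \<le> ell f"
proof (rule LIMSEQ_le_const[OF ell_LIMSEQ[OF assms(1)]])
  have "c * e n 0 \<le> (L ^^ n) f 0" for n
    using iter_mono[of "\<lambda>_. c" f n 0] assms(2) by (simp add: iter_const)
  then show "\<exists>N. \<forall>n\<ge>N. c \<le> (L ^^ n) f 0 / e n 0" using e_pos by (simp add: pos_le_divide_eq)
qed

lemma ell_le:
  assumes "f \<in> holder_space \<alpha>" "\<And>x. f x \<le> c"
  shows "ell f \<le> c"
proof (rule LIMSEQ_le_const2[OF ell_LIMSEQ[OF assms(1)]])
  have "(L ^^ n) f 0 \<le> c * e n 0" for n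
    using iter_mono[of f "\<lambda>_. c" n 0] assms(2) by (simp add: iter_const)
  then show "\<exists>N. \<forall>n\<ge>N. (L ^^ n) f 0 / e n 0 \<le> c" using e_pos by (simp add: pos_divide_le_eq)
qed

lemma ell_e: "ell (e n) = \<rho> ^ n"
proof (induction n)
  case 0
  have "ell (e 0) \<le> 1" "1 \<le> ell (e 0)"
    using ell_le[OF e_holder_space, of 0 1] ell_ge[OF e_holder_space, of 1 0] by (auto simp: e_0)
  then show ?case by simp
qed (simp add: e_Suc ell_L e_holder_space)

text \<open>\<open>\<rho> ^ n = ell (e n)\<close> lies between the lower and upper bounds of
  \<open>e n\<close>, and cone membership keeps those within a factor \<open>exp K\<close>. So the
  normalised iterates are bounded above and away from zero.\<close>

lemma e_le: "e n x \<le> exp K * \<rho> ^ n"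
proof -
  have "exp (- K) * e n x \<le> e n y" for y
  proof -
    have "exp (- K) * e n x \<le> exp (- K) * (exp K * e n y)"
      using log_holder_cone_le[OF e_cone \<alpha> K0(2)] by (intro mult_left_mono) auto
    then show ?thesis by (simp add: mult.assoc[symmetric] exp_add[symmetric])
  qed
  then have "exp (- K) * e n x \<le> \<rho> ^ n" using ell_ge[OF e_holder_space] ell_e by metis
  then have "exp K * (exp (- K) * e n x) \<le> exp K * \<rho> ^ n" by (intro mult_left_mono) auto
  then show ?thesis by (simp add: mult.assoc[symmetric] exp_add[symmetric])
qed

lemma e_ge: "\<rho> ^ n \<le> exp K * e n x"
  using ell_le[OF e_holder_space, of n] log_holder_cone_le[OF e_cone \<alpha> K0(2)] ell_e by metis

lemma \<rho>_pos: "0 < \<rho>"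
proof -
  have "0 < exp K * \<rho> ^ 1" using e_le[of 1 0] e_pos[of 1 0] by linarith
  then show ?thesis by (simp add: zero_less_mult_iff)
qed

text \<open>The product of \<open>2 * (1 + 1 / K)\<close>, the initial width of the squeezing
  interval per unit norm, \<open>exp K\<close> from \<open>e_le\<close>, and
  \<open>2 * exp K\<close>, which covers two Hoelder estimates in
  \<open>iter_remainder\<close>.\<close>

definition iteration_const :: real where "iteration_const = 4 * (1 + 1 / K) * (exp K * exp K)"

lemma iteration_const_ge_1: "1 \<le> iteration_const"
proof -
  have "1 * 1 * (1 * 1) \<le> 4 * (1 + 1 / K) * (exp K * exp K)"
    using K0 by (intro mult_mono) auto
  then show ?thesis by (simp add: iteration_const_def)
qed

text \<open>The squeezing interval controls the supremum. For the Hoelder part, the remainder is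
  written as \<open>p - (ell f - m) * e n\<close> with \<open>p\<close> and \<open>e n\<close> in
  the cone, where a supremum bound already implies a Hoelder bound.\<close>

lemma iter_remainder:
  assumes f: "f \<in> holder_space \<alpha>"
  defines "r \<equiv> \<lambda>n x. (L ^^ n) f x - ell f * e n x"
  defines "B \<equiv> \<lambda>n. iteration_const * \<rho> ^ n * (1 - gap) ^ n * holder_norm \<alpha> f"
  shows "\<bar>r n x\<bar> \<le> B n" "\<bar>r n x - r n y\<bar> \<le> B n * dist x y powr \<alpha>"
proof -
  define \<epsilon> where "\<epsilon> = 2 * (1 + 1 / K) * holder_norm \<alpha> f * (1 - gap) ^ n"
  define E where "E = exp K * \<rho> ^ n"
  obtain m M where s: "squeezed n f m M" and l: "m \<le> ell f" "ell f \<le> M" and \<epsilon>: "M - m = \<epsilon>"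
    using squeezed_limit(2)[OF holder_squeezed[OF f], of n] by (auto simp: \<epsilon>_def)
  have \<epsilon>0: "0 \<le> \<epsilon>" using \<epsilon> l by linarith
  have E0: "0 \<le> E" unfolding E_def using \<rho>_pos by simp
  have B: "B n = 2 * exp K * (\<epsilon> * E)" unfolding B_def \<epsilon>_def E_def iteration_const_def by simp
  have e: "0 < e n x" "e n x \<le> E" for x using e_pos e_le by (auto simp: E_def)
  have "1 \<le> 2 * exp K" using K0 one_le_exp_iff[of K] by linarith
  then have \<epsilon>E: "\<epsilon> * E \<le> B n" unfolding B
    using mult_right_mono[of 1 "2 * exp K" "\<epsilon> * E"] \<epsilon>0 E0 by simp
  have "\<bar>r n x\<bar> \<le> \<epsilon> * e n x"
  proof -
    have "m * e n x \<le> ell f * e n x" "ell f * e n x \<le> M * e n x"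
      using l e(1)[of x] by (auto intro: mult_right_mono)
    then show ?thesis using squeezedD(1,2)[OF s, of x] unfolding r_def \<epsilon>[symmetric] left_diff_distrib by linarith
  qed
  also have "\<dots> \<le> \<epsilon> * E" using e \<epsilon>0 by (intro mult_left_mono) auto
  finally show "\<bar>r n x\<bar> \<le> B n" using \<epsilon>E by linarith
  define p where "p x = (L ^^ n) f x - m * e n x" for x
  have p: "p \<in> cone" using s unfolding squeezed_def p_def by simp
  have "p x \<le> \<epsilon> * E" for x
  proof -
    have "p x \<le> \<epsilon> * e n x" using squeezedD(2)[OF s, of x] unfolding p_def \<epsilon>[symmetric] by (simp add: algebra_simps)
    also have "\<dots> \<le> \<epsilon> * E" using e \<epsilon>0 by (intro mult_left_mono) auto
    finally show ?thesis .
  qed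
  then have 1: "\<bar>p x - p y\<bar> \<le> (exp K - 1) * (\<epsilon> * E) * dist x y powr \<alpha>"
    by (rule log_holder_cone_holder_bound[OF p \<alpha> K0(2)])
  have "\<bar>e n x - e n y\<bar> \<le> (exp K - 1) * E * dist x y powr \<alpha>"
    using e(2) by (rule log_holder_cone_holder_bound[OF e_cone \<alpha> K0(2)])
  then have 2: "\<bar>ell f - m\<bar> * \<bar>e n x - e n y\<bar> \<le> \<epsilon> * ((exp K - 1) * E * dist x y powr \<alpha>)"
    using l \<epsilon> \<epsilon>0 by (intro mult_mono) auto
  have "r n x - r n y = (p x - p y) - (ell f - m) * (e n x - e n y)"
    unfolding r_def p_def by (simp add: algebra_simps)
  then have "\<bar>r n x - r n y\<bar> \<le> \<bar>p x - p y\<bar> + \<bar>(ell f - m) * (e n x - e n y)\<bar>" by simp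
  also have "\<dots> \<le> (exp K - 1) * (\<epsilon> * E) * dist x y powr \<alpha> + \<epsilon> * ((exp K - 1) * E * dist x y powr \<alpha>)"
    unfolding abs_mult by (intro add_mono 1 2)
  also have "\<dots> = (2 * exp K * (\<epsilon> * E) - 2 * (\<epsilon> * E)) * dist x y powr \<alpha>" by (simp add: algebra_simps)
  also have "\<dots> \<le> B n * dist x y powr \<alpha>"
    unfolding B using \<epsilon>0 E0 by (intro mult_right_mono) auto
  finally show "\<bar>r n x - r n y\<bar> \<le> B n * dist x y powr \<alpha>" .
qed

lemma decay:
  assumes f: "f \<in> holder_space \<alpha>" and "ell f = 0"
  shows "holder_norm \<alpha> ((L ^^ n) f) \<le> 2 * iteration_const * \<rho> ^ n * (1 - gap) ^ n * holder_norm \<alpha> f"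
proof -
  let ?B = "iteration_const * \<rho> ^ n * (1 - gap) ^ n * holder_norm \<alpha> f"
  have "0 \<le> ?B" using iteration_const_ge_1 \<rho>_pos gap_bounds holder_norm_nonneg[OF f \<alpha>] by simp
  then have "holder_norm \<alpha> ((L ^^ n) f) \<le> ?B + ?B"
    using iter_remainder[OF f, of n] assms(2) by (intro holder_norm_le) auto
  then show ?thesis by (simp add: algebra_simps)
qed

text \<open>The case \<open>n = 1\<close> of \<open>iter_remainder\<close> splits \<open>L f\<close>
  into a controlled remainder and \<open>ell f * e 1\<close>, with \<open>ell f\<close> bounded by
  the norm of \<open>f\<close>.\<close>

lemma acts_continuously: "acts_continuously (holder_space \<alpha>) (holder_norm \<alpha>) L"
proof -
  define D where "D = iteration_const * \<rho> * (1 - gap)"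
  define E where "E = exp K * \<rho>"
  have D0: "0 \<le> D" "0 \<le> E" unfolding D_def E_def using iteration_const_ge_1 \<rho>_pos gap_bounds by auto
  have "holder_norm \<alpha> (L f) \<le> (2 * D + E + exp K * E) * holder_norm \<alpha> f" if f: "f \<in> holder_space \<alpha>" for f
  proof -
    let ?N = "holder_norm \<alpha> f"
    have N: "0 \<le> ?N" by (rule holder_norm_nonneg[OF f \<alpha>])
    have f_bd: "- ?N \<le> f x" "f x \<le> ?N" for x using holder_space_bounds(1)[OF f \<alpha>, of x] by auto
    have l: "\<bar>ell f\<bar> \<le> ?N" using ell_le[OF f f_bd(2)] ell_ge[OF f f_bd(1)] by (simp add: abs_le_iff)
    define r where "r x = L f x - ell f * e 1 x" for x
    have r: "\<bar>r x\<bar> \<le> D * ?N" "\<bar>r x - r y\<bar> \<le> D * ?N * dist x y powr \<alpha>" for x y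
      using iter_remainder[OF f, of 1] by (auto simp: r_def D_def)
    have e1: "0 < e 1 x" "e 1 x \<le> E" for x using e_pos e_le[of 1] by (auto simp: E_def)
    have e2: "\<bar>e 1 x - e 1 y\<bar> \<le> (exp K - 1) * E * dist x y powr \<alpha>" for x y
      using e1(2) by (rule log_holder_cone_holder_bound[OF e_cone \<alpha> K0(2)])
    have Lf: "L f x = r x + ell f * e 1 x" for x by (simp add: r_def)
    have "holder_norm \<alpha> (L f) \<le> (D * ?N + ?N * E) + (D * ?N + ?N * ((exp K - 1) * E))"
    proof (rule holder_norm_le)
      fix x y
      have "\<bar>ell f * e 1 x\<bar> \<le> ?N * E" unfolding abs_mult using l e1[of x] N by (intro mult_mono) auto
      then show "\<bar>L f x\<bar> \<le> D * ?N + ?N * E" unfolding Lf using r(1)[of x] by linarith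
      have "\<bar>ell f * (e 1 x - e 1 y)\<bar> \<le> ?N * ((exp K - 1) * E * dist x y powr \<alpha>)"
        unfolding abs_mult using l e2 N by (intro mult_mono) auto
      moreover have "L f x - L f y = (r x - r y) + ell f * (e 1 x - e 1 y)" by (simp add: Lf algebra_simps)
      ultimately have "\<bar>L f x - L f y\<bar> \<le> D * ?N * dist x y powr \<alpha> + ?N * ((exp K - 1) * E * dist x y powr \<alpha>)"
        using r(2)[of x y] by linarith
      then show "\<bar>L f x - L f y\<bar> \<le> (D * ?N + ?N * ((exp K - 1) * E)) * dist x y powr \<alpha>"
        by (simp add: algebra_simps)
    next
      show "0 \<le> D * ?N + ?N * ((exp K - 1) * E)" using D0 N K0 by simp
    qed
    also have "\<dots> = (2 * D + exp K * E) * ?N" by (simp add: algebra_simps)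
    also have "\<dots> \<le> (2 * D + E + exp K * E) * ?N" using D0 N by (intro mult_right_mono) auto
    finally show ?thesis .
  qed
  then show ?thesis unfolding acts_continuously_def using L_holder_space by blast
qed

text \<open>\<open>iter_remainder\<close> applied to \<open>e 1\<close>, for which
  \<open>ell (e 1) = \<rho>\<close>, makes successive differences of \<open>e n / \<rho> ^ n\<close>
  decay geometrically. The limit stays in the cone, and \<open>e_ge\<close> keeps it at least
  \<open>exp (- K)\<close>.\<close>

lemma eigenfunction:
  obtains h where "h \<in> holder_space \<alpha>" "\<And>x. 0 < h x" "\<And>x. L h x = \<rho> * h x"
proof -
  define h' where "h' n x = e n x / \<rho> ^ n" for n x
  define N where "N = holder_norm \<alpha> (e 1)"
  have L1: "L (\<lambda>_. 1) = e 1" by (simp add: e_def)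
  have "convergent (\<lambda>n. h' n x)" for x
  proof -
    have bound: "norm (h' (Suc n) x - h' n x) \<le> iteration_const * N / \<rho> * (1 - gap) ^ n" for n
    proof -
      have "\<bar>e (Suc n) x - \<rho> * e n x\<bar> \<le> iteration_const * \<rho> ^ n * (1 - gap) ^ n * N"
        using iter_remainder(1)[OF e_holder_space[of 1], of n x] unfolding e_Suc' L1 N_def
        by (simp add: \<rho>_def L1)
      then have "\<bar>e (Suc n) x - \<rho> * e n x\<bar> / \<rho> ^ Suc n \<le> (iteration_const * \<rho> ^ n * (1 - gap) ^ n * N) / \<rho> ^ Suc n"
        using \<rho>_pos by (intro divide_right_mono) auto
      also have "\<dots> = iteration_const * N / \<rho> * (1 - gap) ^ n" using \<rho>_pos by simp
      also have "\<bar>e (Suc n) x - \<rho> * e n x\<bar> / \<rho> ^ Suc n = \<bar>(e (Suc n) x - \<rho> * e n x) / \<rho> ^ Suc n\<bar>"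
        using \<rho>_pos by simp
      also have "(e (Suc n) x - \<rho> * e n x) / \<rho> ^ Suc n = h' (Suc n) x - h' n x"
        unfolding h'_def using \<rho>_pos by (simp add: diff_divide_distrib)
      finally show ?thesis by simp
    qed
    have sg: "summable (\<lambda>n. iteration_const * N / \<rho> * (1 - gap) ^ n)"
      using gap_bounds by (intro summable_mult summable_geometric) auto
    have "summable (\<lambda>n. h' (Suc n) x - h' n x)"
      by (rule summable_comparison_test'[OF sg bound])
    then have "convergent (\<lambda>n. h' n x - h' 0 x)"
      unfolding summable_iff_convergent sum_lessThan_telescope[of "\<lambda>n. h' n x"] .
    then have "convergent (\<lambda>n. (h' n x - h' 0 x) + h' 0 x)"
      by (rule convergent_add[OF _ convergent_const])
    then show ?thesis by simp
  qed
  then obtain h where h: "\<And>x. (\<lambda>n. h' n x) \<longlonglongrightarrow> h x" unfolding convergent_def by metis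
  have "h' n \<in> cone" for n
    using log_holder_cone_scale[OF e_cone, of "1 / \<rho> ^ n" n] \<rho>_pos by (simp add: h'_def[abs_def])
  then have "h \<in> cone" using h by (rule log_holder_cone_limit)
  moreover have "0 < h x" for x
  proof -
    have "exp (- K) \<le> h' n x" for n
      using e_ge[of n x] \<rho>_pos by (simp add: h'_def exp_minus field_simps)
    then have "exp (- K) \<le> h x" by (intro LIMSEQ_le_const[OF h]) auto
    then show ?thesis using exp_gt_zero[of "- K"] by linarith
  qed
  moreover have "L h x = \<rho> * h x" for x
  proof -
    have "(\<lambda>n. \<Sum>y | T y = x. exp (A y) * h' n y) \<longlonglongrightarrow> (\<Sum>y | T y = x. exp (A y) * h y)"
      by (intro tendsto_intros h)
    moreover have "(\<Sum>y | T y = x. exp (A y) * h' n y) = \<rho> * h' (Suc n) x" for n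
      using \<rho>_pos by (simp add: h'_def e_Suc transfer_operator_def sum_divide_distrib sum_distrib_left)
    moreover have "(\<lambda>n. \<rho> * h' (Suc n) x) \<longlonglongrightarrow> \<rho> * h x"
      by (intro tendsto_intros LIMSEQ_Suc h)
    ultimately show ?thesis unfolding transfer_operator_def using LIMSEQ_unique by fastforce
  qed
  ultimately show ?thesis using that cone_subset by blast
qed

end

section \<open>The eigenmeasure\<close>

lemma ex_unit_interval_representative: "\<exists>t. to_circle t = p \<and> 0 \<le> t \<and> t < 1"
proof -
  obtain s where s: "to_circle s = p" using to_circle_surj by blast
  have "to_circle (frac s) = to_circle s" by (simp add: to_circle_eq_iff frac_def)
  then show ?thesis using s frac_ge_0 frac_lt_1 by metis
qed

text \<open>
  Weak limits of probability measures on the circle are obtained from Helly's selection theorem on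
  the line, applied to the measures carried by the representatives in \<open>[0, 1)\<close>.
\<close>

lemma circle_weak_limit:
  fixes p :: "nat \<Rightarrow> circle pmf"
  obtains \<nu> :: "circle measure" and r :: "nat \<Rightarrow> nat" where "sets \<nu> = sets borel" "prob_space \<nu>" "strict_mono r"
    "\<And>f B. continuous_on UNIV f \<Longrightarrow> (\<And>x. \<bar>f x\<bar> \<le> B) \<Longrightarrow>
      (\<lambda>n. integral\<^sup>L (measure_pmf (p (r n))) f) \<longlonglongrightarrow> integral\<^sup>L \<nu> (f :: circle \<Rightarrow> real)"
proof -
  obtain rep where rep: "\<And>p. to_circle (rep p) = p" "\<And>p. 0 \<le> rep p" "\<And>p. rep p < 1"
    using ex_unit_interval_representative by metis
  define \<mu> where "\<mu> n = distr (measure_pmf (p n)) borel rep" for n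
  have real: "real_distribution (\<mu> n)" for n
    unfolding \<mu>_def real_distribution_def real_distribution_axioms_def
    by (auto intro!: prob_space.prob_space_distr measure_pmf.prob_space_axioms)
  have "measure (\<mu> n) {-1<..1} = 1" for n
  proof -
    have "rep -` {-1<..1} = UNIV"
    proof (intro set_eqI iffI UNIV_I)
      fix q show "q \<in> rep -` {-1<..1}" using rep(2,3)[of q] by simp
    qed
    then show ?thesis unfolding \<mu>_def using measure_pmf.prob_space[of "p n"]
      by (subst measure_distr) auto
  qed
  then have "tight \<mu>" unfolding tight_def
    by (intro conjI allI impI real exI[of _ "-1"] exI[of _ 1]) auto
  from tight_imp_convergent_subsubsequence[OF this strict_mono_id]
  obtain r M where r: "strict_mono r" and M: "real_distribution M" and conv: "weak_conv_m (\<mu> \<circ> r) M" by auto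
  interpret M: real_distribution M by (rule M)
  have meas: "to_circle \<in> M \<rightarrow>\<^sub>M borel"
    using borel_measurable_continuous_onI[OF continuous_on_to_circle] by simp
  show ?thesis
  \<comment> \<open>\<open>rep\<close> is discontinuous, but the weak limit is tested only on
    \<open>f (to_circle t)\<close>, which is continuous on the line and gives back \<open>f\<close>
    along \<open>rep\<close>. Mass that drifts to 1 in the limit returns to the point
    \<open>0\<close>.\<close>
  proof (rule that[of "distr M borel to_circle" r])
    show "prob_space (distr M borel to_circle)" by (rule M.prob_space_distr[OF meas])
    fix f :: "circle \<Rightarrow> real" and B assume f: "continuous_on UNIV f" and B: "\<And>x. \<bar>f x\<bar> \<le> B"
    have fm: "f \<in> borel_measurable borel" using f by (rule borel_measurable_continuous_onI)
    have ft: "continuous_on UNIV (\<lambda>t. f (to_circle t))"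
      by (intro continuous_on_compose2[OF f] continuous_on_to_circle) auto
    then have ftm: "(\<lambda>t. f (to_circle t)) \<in> borel_measurable borel" by (rule borel_measurable_continuous_onI)
    have "(\<lambda>n. integral\<^sup>L ((\<mu> \<circ> r) n) (\<lambda>t. f (to_circle t))) \<longlonglongrightarrow> integral\<^sup>L M (\<lambda>t. f (to_circle t))"
      using real M conv ft B
      by (intro weak_conv_imp_integral_bdd_continuous_conv[where B = B])
        (auto simp: continuous_on_eq_continuous_at comp_def)
    moreover have "integral\<^sup>L ((\<mu> \<circ> r) n) (\<lambda>t. f (to_circle t)) = integral\<^sup>L (measure_pmf (p (r n))) f" for n
      unfolding \<mu>_def comp_def by (subst integral_distr) (use ftm rep in auto)
    moreover have "integral\<^sup>L (distr M borel to_circle) f = integral\<^sup>L M (\<lambda>t. f (to_circle t))"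
      by (rule integral_distr[OF meas fm])
    ultimately show "(\<lambda>n. integral\<^sup>L (measure_pmf (p (r n))) f) \<longlonglongrightarrow> integral\<^sup>L (distr M borel to_circle) f"
      by simp
  qed (use r in auto)
qed

context cone_contraction
begin

text \<open>Evaluating an iterate at \<open>0\<close> is a nonnegative combination of finitely many
  point evaluations; an application of \<open>L\<close> replaces each support point by its fibre.
  Normalised by \<open>e n 0\<close>, the weights become the probability measures that converge to
  the eigenmeasure.\<close>

lemma iter_kernel:
  obtains Q w where "finite Q" "\<And>y. 0 \<le> w y" "\<And>f. (L ^^ n) f 0 = (\<Sum>y\<in>Q. w y * f y)"
proof (induction n arbitrary: thesis)
  case 0
  show ?case by (rule 0[of "{0}" "\<lambda>_. 1"]) auto
next
  case (Suc n)
  obtain Q w where Q: "finite Q" "\<And>y. 0 \<le> w y" "\<And>f. (L ^^ n) f 0 = (\<Sum>y\<in>Q. w y * f y)"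
    using Suc.IH by metis
  define R where "R = (\<Union>x\<in>Q. {y. T y = x})"
  have R: "finite R" unfolding R_def using Q(1) finite_fibre by blast
  have "(L ^^ Suc n) f 0 = (\<Sum>y\<in>R. w (T y) * exp (A y) * f y)" for f
  proof -
    have "(L ^^ Suc n) f 0 = (L ^^ n) (L f) 0" by (simp add: funpow_swap1)
    also have "\<dots> = (\<Sum>x\<in>Q. \<Sum>y | y \<in> R \<and> T y = x. w (T y) * exp (A y) * f y)"
      unfolding Q(3) transfer_operator_def sum_distrib_left
      by (intro sum.cong) (auto simp: R_def mult.assoc)
    also have "\<dots> = (\<Sum>y\<in>R. w (T y) * exp (A y) * f y)"
      by (rule sum.group[OF R Q(1)]) (auto simp: R_def)
    finally show ?thesis .
  qed
  then show ?case using Q(2) by (intro Suc.prems[OF R, of "\<lambda>y. w (T y) * exp (A y)"]) auto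
qed

lemma ex_iter_pmf: "\<exists>p. \<forall>f. integral\<^sup>L (measure_pmf p) f = (L ^^ n) f 0 / e n 0"
proof -
  obtain Q w where Q: "finite Q" "\<And>y. 0 \<le> w y" "\<And>f. (L ^^ n) f 0 = (\<Sum>y\<in>Q. w y * f y)"
    using iter_kernel[of n] by blast
  have e: "e n 0 = (\<Sum>y\<in>Q. w y)" unfolding e_def Q(3) by simp
  define v where "v y = (if y \<in> Q then w y / e n 0 else 0)" for y
  have v0: "0 \<le> v y" for y unfolding v_def using Q(2) e_pos[of n 0] by simp
  have "(\<integral>\<^sup>+ y. ennreal (v y) \<partial>count_space UNIV) = (\<Sum>y\<in>Q. ennreal (v y))"
    by (rule nn_integral_count_space'[OF Q(1)]) (auto simp: v_def)
  also have "\<dots> = ennreal (\<Sum>y\<in>Q. v y)" using v0 by (rule sum_ennreal)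
  also have "(\<Sum>y\<in>Q. v y) = 1"
    using e_pos[of n 0] unfolding v_def by (simp add: sum_divide_distrib[symmetric] e)
  finally have v1: "(\<integral>\<^sup>+ y. ennreal (v y) \<partial>count_space UNIV) = 1" by simp
  have "integral\<^sup>L (measure_pmf (embed_pmf v)) f = (L ^^ n) f 0 / e n 0" for f
  proof -
    have "integral\<^sup>L (measure_pmf (embed_pmf v)) f = (\<Sum>y\<in>Q. f y * pmf (embed_pmf v) y)"
      by (rule integral_measure_pmf_real[OF Q(1)])
        (auto simp: set_embed_pmf[OF v0 v1] v_def split: if_splits)
    also have "\<dots> = (\<Sum>y\<in>Q. w y * f y) / e n 0"
      unfolding pmf_embed_pmf[OF v0 v1] v_def sum_divide_distrib by (intro sum.cong) auto
    finally show ?thesis by (simp add: Q(3))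
  qed
  then show ?thesis by blast
qed

text \<open>Helly's theorem only yields a subsequence, but the integrals of a Hoelder function
  converge to \<open>ell f\<close> along the full sequence, so the limit measure has to represent
  \<open>ell\<close>.\<close>

lemma eigenmeasure:
  obtains \<nu> :: "circle measure" where "sets \<nu> = sets borel" "prob_space \<nu>"
    "\<And>f. f \<in> holder_space \<alpha> \<Longrightarrow> integral\<^sup>L \<nu> f = ell f"
proof -
  obtain p where p: "\<And>n f. integral\<^sup>L (measure_pmf (p n)) f = (L ^^ n) f 0 / e n 0"
    using ex_iter_pmf by metis
  obtain \<nu> :: "circle measure" and r where \<nu>: "sets \<nu> = sets borel" "prob_space \<nu>" and r: "strict_mono r"
    and conv: "\<And>f B. continuous_on UNIV f \<Longrightarrow> (\<And>x. \<bar>f x\<bar> \<le> B) \<Longrightarrow>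
      (\<lambda>n. integral\<^sup>L (measure_pmf (p (r n))) f) \<longlonglongrightarrow> integral\<^sup>L \<nu> (f :: circle \<Rightarrow> real)"
    using circle_weak_limit[of p] by blast
  have "integral\<^sup>L \<nu> f = ell f" if f: "f \<in> holder_space \<alpha>" for f
  proof -
    have "(\<lambda>n. (L ^^ r n) f 0 / e (r n) 0) \<longlonglongrightarrow> integral\<^sup>L \<nu> f"
      using conv[OF continuous_on_holder_space[OF f \<alpha>] holder_space_bounds(1)[OF f \<alpha>]] unfolding p .
    moreover have "(\<lambda>n. (L ^^ r n) f 0 / e (r n) 0) \<longlonglongrightarrow> ell f"
      using LIMSEQ_subseq_LIMSEQ[OF ell_LIMSEQ[OF f] r] by (simp add: comp_def)
    ultimately show ?thesis by (rule LIMSEQ_unique)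
  qed
  with \<nu> show ?thesis by (rule that)
qed

theorem spectral_gap: "has_spectral_gap (holder_space \<alpha>) (holder_norm \<alpha>) L"
proof -
  obtain h where h: "h \<in> holder_space \<alpha>" "\<And>x. 0 < h x" "\<And>x. L h x = \<rho> * h x"
    using eigenfunction by blast
  obtain \<nu> :: "circle measure" where \<nu>: "sets \<nu> = sets borel" "prob_space \<nu>"
    "\<And>f. f \<in> holder_space \<alpha> \<Longrightarrow> integral\<^sup>L \<nu> f = ell f"
    using eigenmeasure by blast
  interpret prob_space \<nu> by (rule \<nu>(2))
  have "space \<nu> = UNIV" using sets_eq_imp_space_eq[OF \<nu>(1)] by simp
  then have nz: "emeasure \<nu> UNIV \<noteq> 0" using emeasure_space_1 by simp
  have eig: "integral\<^sup>L \<nu> (L f) = \<rho> * integral\<^sup>L \<nu> f" if "f \<in> holder_space \<alpha>" for f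
    using that by (simp add: \<nu>(3) L_holder_space ell_L)
  have dec: "holder_norm \<alpha> ((L ^^ t) f) \<le> (2 * iteration_const) * \<rho> ^ t * (1 - gap) ^ t * holder_norm \<alpha> f"
    if "f \<in> holder_space \<alpha>" "integral\<^sup>L \<nu> f = 0" for f t
    using that decay by (simp add: \<nu>(3))
  have C: "1 \<le> 2 * iteration_const" using iteration_const_ge_1 by simp
  have "\<exists>C \<delta>. C \<ge> 1 \<and> 0 < \<delta> \<and> \<delta> < 1 \<and>
      (\<forall>t. \<forall>f\<in>holder_space \<alpha>. integral\<^sup>L \<nu> f = 0 \<longrightarrow>
        holder_norm \<alpha> ((L ^^ t) f) \<le> C * \<rho> ^ t * (1 - \<delta>) ^ t * holder_norm \<alpha> f)"
    using C gap_bounds dec by blast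
  then show ?thesis
    unfolding has_spectral_gap_def
    using acts_continuously h \<rho>_pos \<nu>(1) finite_measure_axioms nz eig by blast
qed

end

section \<open>Flat potentials\<close>

text \<open>
  The approximation replaces \<open>f - f 0\<close> by its soft threshold, so that
  the error \<open>f x - f 0\<close> clamped to \<open>[-\<tau>, \<tau>]\<close> has the same \<open>\<alpha>\<close>-Hoelder bound as \<open>f\<close>; interpolating
  with its small supremum norm makes it small in the weaker \<open>\<gamma>\<close>-norm.
\<close>

lemma flat_potentials_dense:
  assumes \<gamma>: "0 < \<gamma>" "\<gamma> < \<alpha>"
  shows "dense_for_norm (holder_norm \<gamma>) (flat_potentials \<alpha>) (holder_space \<alpha>)"
  unfolding dense_for_norm_def
proof (intro conjI ballI allI impI)
  show "flat_potentials \<alpha> \<subseteq> holder_space \<alpha>" by (auto simp: flat_potentials_def)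
  fix f and \<epsilon> :: real assume f: "f \<in> holder_space \<alpha>" and \<epsilon>: "0 < \<epsilon>"
  have \<alpha>: "0 < \<alpha>" using \<gamma> by simp
  define N where "N = holder_norm \<alpha> f"
  have N: "0 \<le> N" unfolding N_def by (rule holder_norm_nonneg[OF f \<alpha>])
  have fN: "\<bar>f x - f y\<bar> \<le> N * dist x y powr \<alpha>" for x y
    unfolding N_def by (rule holder_space_bounds(2)[OF f \<alpha>])
  \<comment> \<open>With \<open>s powr (\<alpha> - \<gamma>) = b\<close> and
    \<open>2 * \<tau> = s powr \<alpha>\<close>, the \<alpha>-bound handles distances up to
    \<open>s\<close> and the bound \<open>2 * \<tau> = b * s powr \<gamma>\<close> handles larger
    ones. Both give a \<gamma>-constant of at most \<open>(N + 1) * b\<close>; the denominator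
    \<open>N + 3\<close> leaves room for the supremum \<tau> and a strict inequality.\<close>
  define b where "b = min 1 (\<epsilon> / (N + 3))"
  have b: "0 < b" "b \<le> 1" "b \<le> \<epsilon> / (N + 3)" unfolding b_def using \<epsilon> N by auto
  define s where "s = b powr (1 / (\<alpha> - \<gamma>))"
  have s: "0 < s" "s \<le> 1" "s powr (\<alpha> - \<gamma>) = b"
    unfolding s_def using b \<gamma> by (auto simp: powr_powr intro!: powr_le1)
  define \<tau> where "\<tau> = s powr \<alpha> / 2"
  have \<tau>: "0 < \<tau>" unfolding \<tau>_def using s by simp
  have "s powr \<alpha> \<le> s powr (\<alpha> - \<gamma>)" using s \<gamma> by (intro powr_mono') auto
  then have \<tau>b: "2 * \<tau> \<le> b" using s by (simp add: \<tau>_def)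
  define clamp where "clamp v = max (- \<tau>) (min \<tau> v)" for v :: real
  have clamp: "\<bar>clamp v\<bar> \<le> \<tau>" "\<bar>clamp v - clamp w\<bar> \<le> \<bar>v - w\<bar>" for v w
    unfolding clamp_def using \<tau> by linarith+
  define d where "d x = clamp (f x - f 0)" for x
  have d1: "\<bar>d x\<bar> \<le> \<tau>" for x unfolding d_def by (rule clamp)
  have d2: "\<bar>d x - d y\<bar> \<le> N * dist x y powr \<alpha>" for x y
    using clamp(2)[of "f x - f 0" "f y - f 0"] fN[of x y] unfolding d_def by simp
  define g where "g x = 1 * f x + (- 1) * d x" for x
  have "g \<in> holder_space \<alpha>"
    unfolding g_def[abs_def] using f holder_spaceI[OF d2] by (rule holder_space_linear)
  moreover have "\<exists>M. 0 \<in> interior M \<and> g constant_on M"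
  proof (intro exI conjI)
    let ?M = "{x. \<bar>f x - f 0\<bar> < \<tau>}"
    have "open ?M"
      by (intro open_Collect_less continuous_intros continuous_on_holder_space[OF f \<alpha>])
    then show "0 \<in> interior ?M" using \<tau> by (simp add: interior_open)
    show "g constant_on ?M" unfolding constant_on_def
      by (rule exI[of _ "f 0"]) (auto simp: g_def d_def clamp_def)
  qed
  ultimately have "g \<in> flat_potentials \<alpha>" by (simp add: flat_potentials_def)
  moreover have "holder_norm \<gamma> (\<lambda>x. f x - g x) < \<epsilon>"
  proof -
    have fg: "(\<lambda>x. f x - g x) = d" by (simp add: g_def)
    have "\<bar>d x - d y\<bar> \<le> (N + 1) * b * dist x y powr \<gamma>" for x y
    proof (cases "x = y")
      case False
      define t where "t = dist x y"
      have t: "0 < t" using False by (simp add: t_def)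
      show ?thesis
      proof (cases "t \<le> s")
        case True
        have "t powr \<alpha> = t powr (\<alpha> - \<gamma>) * t powr \<gamma>" by (simp add: powr_add[symmetric])
        also have "\<dots> \<le> b * t powr \<gamma>"
          using powr_mono2[of "\<alpha> - \<gamma>" t s] True t \<gamma> s by (intro mult_right_mono) auto
        finally have "N * t powr \<alpha> \<le> N * (b * t powr \<gamma>)" using N by (intro mult_left_mono) auto
        also have "\<dots> \<le> (N + 1) * (b * t powr \<gamma>)" using b by (intro mult_right_mono) auto
        finally show ?thesis using d2[of x y] by (simp add: t_def)
      next
        case False
        have "\<bar>d x - d y\<bar> \<le> 2 * \<tau>" using d1[of x] d1[of y] by linarith
        also have "\<dots> = b * s powr \<gamma>"
          using s by (simp add: \<tau>_def s(3)[symmetric] powr_add[symmetric] del: s(3))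
        also have "\<dots> \<le> b * t powr \<gamma>" using False s \<gamma> b by (intro mult_left_mono powr_mono2) auto
        also have "\<dots> \<le> (N + 1) * (b * t powr \<gamma>)"
          using mult_right_mono[of 1 "N + 1" "b * t powr \<gamma>"] N b by simp
        finally show ?thesis by (simp add: t_def)
      qed
    qed simp
    then have "holder_norm \<gamma> d \<le> \<tau> + (N + 1) * b"
      using d1 N b by (intro holder_norm_le) auto
    also have "\<dots> < b * (N + 3)" using \<tau>b b(1) \<tau> by (simp add: algebra_simps)
    also have "\<dots> \<le> \<epsilon>" using b(3) N by (simp add: pos_le_divide_eq)
    finally show ?thesis unfolding fg .
  qed
  ultimately show "\<exists>g\<in>flat_potentials \<alpha>. holder_norm \<gamma> (\<lambda>x. f x - g x) < \<epsilon>" by blast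
qed

lemma flat_potential_spectral_gap:
  fixes T :: "circle \<Rightarrow> circle"
  assumes k: "k \<ge> 2" and cov: "covering_space UNIV T UNIV" and card: "\<And>x. card (T -` {x}) = k"
    and exp: "uniformly_expanding_away_from T 0" and \<alpha>: "0 < \<alpha>" and A: "A \<in> flat_potentials \<alpha>"
  shows "has_spectral_gap (holder_space \<alpha>) (holder_norm \<alpha>) (transfer_operator T A)"
proof -
  have AH: "A \<in> holder_space \<alpha>" using A by (simp add: flat_potentials_def)
  obtain M where M: "0 \<in> interior M" "A constant_on M"
    using A by (auto simp: flat_potentials_def)
  then obtain r where r: "r > 0" "ball 0 r \<subseteq> M" unfolding mem_interior by blast
  obtain \<eta> \<theta> where \<eta>: "0 < \<eta>" "\<eta> \<le> r" and \<theta>: "0 < \<theta>" "\<theta> < 1"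
    and pairing: "\<And>x y. \<exists>p q. bij_betw p {..<k} (T -` {x}) \<and> bij_betw q {..<k} (T -` {y}) \<and>
      (\<forall>j<k. dist (p j) (q j) \<le> dist x y \<and>
        (p j \<in> ball 0 \<eta> \<and> q j \<in> ball 0 \<eta> \<or> dist (p j) (q j) \<le> \<theta> * dist x y)) \<and>
      (\<exists>j<k. dist (p j) (q j) \<le> \<theta> * dist x y)"
    using fibre_pairing[OF k cov card exp r(1)] by blast
  have "ball 0 \<eta> \<subseteq> M" using \<eta>(2) r(2) by auto
  then have flat: "A constant_on ball 0 \<eta>" using M(2) constant_on_subset by blast
  obtain K K' where K: "0 < K'" "K' < K"
    "\<And>f. f \<in> log_holder_cone \<alpha> K \<Longrightarrow> transfer_operator T A f \<in> log_holder_cone \<alpha> K'"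
    using transfer_operator_improves_cone[OF k card holder_norm_nonneg[OF AH \<alpha>] holder_space_bounds(2)[OF AH \<alpha>] \<alpha>
        flat \<theta> pairing] by blast
  have fib: "{y. T y = x} = T -` {x}" for x by auto
  have "finite {y. T y = x}" "{y. T y = x} \<noteq> {}" for x
    using card[of x] k unfolding fib by (auto intro: card_ge_0_finite)
  then interpret cone_contraction T A \<alpha> K K' using \<alpha> K by unfold_locales auto
  show ?thesis by (rule spectral_gap)
qed

theorem theorem3:
  fixes T :: "circle \<Rightarrow> circle" and k :: nat and \<alpha> :: real
  assumes "k \<ge> 2"
    and "covering_space UNIV T UNIV"
    and "\<forall>x. card (T -` {x}) = k"
    and "T 0 = 0"
    and "neutral_at T 0"
    and "uniformly_expanding_away_from T 0"
    and "0 < \<alpha>" and "\<alpha> \<le> 1"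
  shows "(\<forall>A\<in>flat_potentials \<alpha>.
            has_spectral_gap (holder_space \<alpha>) (holder_norm \<alpha>) (transfer_operator T A)) \<and>
         (\<forall>\<gamma>. 0 < \<gamma> \<and> \<gamma> < \<alpha> \<longrightarrow>
            dense_for_norm (holder_norm \<gamma>) (flat_potentials \<alpha>) (holder_space \<alpha>))"
  using flat_potential_spectral_gap[of k T] flat_potentials_dense assms by blast

end
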